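(* Let $\mathcal{H}$ be a real Hilbert space, $M\colon\mathcal{H}\to 2^{\mathcal{H}}$ a maximally monotone operator and $C\colon\mathcal{H}\to\mathcal{H}$ a $\beta$-cocoercive operator with $\beta>0$, such that $\mathcal{Z}:=\{z\in\mathcal{H} : 0\in M(z)+C(z)\}\neq\emptyset$. Let $\alpha>2$ and $0<\gamma<\frac{8(\alpha-1)}{5\alpha-2}\beta$. Let $z_0,y_0\in\mathcal{H}$, $z_1:=J_{\gamma M}(y_0-\gamma C(z_0))$, and for every $k\ge 1$ $$y_k:=z_k+\Big(1-\frac{\alpha}{k+\alpha}\Big)(z_k-z_{k-1})+\Big(1-\frac{\alpha}{2(k+\alpha)}\Big)(y_{k-1}-z_k),\qquad z_{k+1}:=J_{\gamma M}\big(y_k-\gamma C(z_k)\big).$$ For every $k\ge 1$ let $\xi_k:=\frac1\gamma(y_{k-1}-z_k)-C(z_{k-1})$, which belongs to $M(z_k)$. Let $z_*\in\mathcal{Z}$. Then: (i) the sequence $(z_k)_{k\ge0}$ converges weakly to an element of $\mathcal{Z}$; (ii) as $k\to+\infty$, $$\|z_k-z_{k-1}\|=o\Big(\frac1k\Big),\qquad \langle z_k-z_*,\xi_k+C(z_k)\rangle=o\Big(\frac1k\Big),\qquad \|\xi_k+C(z_k)\|=o\Big(\frac1k\Big),$$ and consequently $$\operatorname{dist}\big(0,M(z_k)+C(z_k)\big)=o\Big(\frac1k\Big),\qquad \big\|z_k-J_{\gamma M}\big(z_k-\gamma C(z_k)\big)\big\|=o\Big(\frac1k\Big).$$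
   Context: An operator $C\colon\mathcal{H}\to\mathcal{H}$ is $\beta$-cocoercive if $\langle C(z)-C(y),z-y\rangle\ge\beta\|C(z)-C(y)\|^2$ for all $z,y\in\mathcal{H}$. For $\gamma>0$, $J_{\gamma M}:=(\mathrm{Id}+\gamma M)^{-1}$ is the resolvent of $M$, which is single-valued and defined on all of $\mathcal{H}$ when $M$ is maximally monotone. $\operatorname{dist}(0,M(z)+C(z))=\inf_{\xi\in M(z)}\|\xi+C(z)\|$. *)

theory Defs
  imports "HOL-Analysis.Analysis" "HOL-Library.Landau_Symbols"
begin

text \<open>Set-valued operators on a space are rendered as functions of type
  \<^typ>\<open>'a \<Rightarrow> 'a set\<close>. A real Hilbert space is a type of sort \<open>{real_inner, complete_space}\<close>.\<close>

definition monotone_operator :: "('a::real_inner \<Rightarrow> 'a set) \<Rightarrow> bool" where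
  "monotone_operator M \<longleftrightarrow>
     (\<forall>x y. \<forall>u\<in>M x. \<forall>v\<in>M y. (u - v) \<bullet> (x - y) \<ge> 0)"

text \<open>Pointwise inclusion of set-valued operators is inclusion of their graphs.\<close>

definition maximally_monotone :: "('a::real_inner \<Rightarrow> 'a set) \<Rightarrow> bool" where
  "maximally_monotone M \<longleftrightarrow> monotone_operator M \<and>
     (\<forall>N. monotone_operator N \<and> (\<forall>x. M x \<subseteq> N x) \<longrightarrow> N = M)"

definition cocoercive :: "real \<Rightarrow> ('a::real_inner \<Rightarrow> 'a) \<Rightarrow> bool" where
  "cocoercive \<beta> C \<longleftrightarrow>
     (\<forall>z y. (C z - C y) \<bullet> (z - y) \<ge> \<beta> * (norm (C z - C y))\<^sup>2)"

definition operator_sum :: "('a::real_inner \<Rightarrow> 'a set) \<Rightarrow> ('a \<Rightarrow> 'a) \<Rightarrow> 'a \<Rightarrow> 'a set" where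
  "operator_sum M C z = {\<xi> + C z |\<xi>. \<xi> \<in> M z}"

definition sum_zeros :: "('a::real_inner \<Rightarrow> 'a set) \<Rightarrow> ('a \<Rightarrow> 'a) \<Rightarrow> 'a set" where
  "sum_zeros M C = {z. 0 \<in> operator_sum M C z}"

text \<open>The set-valued operator \<open>(Id + \<gamma> M)\<^sup>-\<^sup>1\<close>, and the function \<open>J\<close> it
  determines. The description in \<open>resolvent\<close> is meaningful where the former is a
  singleton, which by Minty's theorem is everywhere if \<open>M\<close> is maximally monotone
  and \<open>\<gamma> > 0\<close>.\<close>

definition resolvent_set :: "real \<Rightarrow> ('a::real_inner \<Rightarrow> 'a set) \<Rightarrow> 'a \<Rightarrow> 'a set" where
  "resolvent_set \<gamma> M x = {p. x \<in> {p + \<gamma> *\<^sub>R u |u. u \<in> M p}}"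

definition resolvent :: "real \<Rightarrow> ('a::real_inner \<Rightarrow> 'a set) \<Rightarrow> 'a \<Rightarrow> 'a" where
  "resolvent \<gamma> M x = (THE p. p \<in> resolvent_set \<gamma> M x)"

text \<open>Weak convergence in a Hilbert space: the weak topology is the coarsest one for
  which all functionals \<open>\<lambda>x. x \<bullet> v\<close> are continuous.\<close>

definition weakly_converges :: "(nat \<Rightarrow> 'a::real_inner) \<Rightarrow> 'a \<Rightarrow> bool" where
  "weakly_converges x l \<longleftrightarrow> (\<forall>v. (\<lambda>k. x k \<bullet> v) \<longlonglongrightarrow> l \<bullet> v)"

end

theory Submission
  imports Defs
begin

text \<open>
  Let \<open>x\<^sub>n = z\<^sub>n - z\<^sub>*\<close>, \<open>d\<^sub>n = z\<^sub>n - z\<^sub>n\<^sub>-\<^sub>1\<close>,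
  \<open>v\<^sub>n = (y\<^sub>n\<^sub>-\<^sub>1 - z\<^sub>n) / \<gamma> = \<xi>\<^sub>n + C z\<^sub>n\<^sub>-\<^sub>1\<close> and
  \<open>c\<^sub>n = C z\<^sub>n - C z\<^sub>n\<^sub>-\<^sub>1\<close>. The scheme reads
  \<open>(n + \<alpha>) d\<^sub>n\<^sub>+\<^sub>1 = n d\<^sub>n - \<gamma> (n + \<alpha>) (v\<^sub>n\<^sub>+\<^sub>1 - v\<^sub>n) - \<gamma> \<alpha> v\<^sub>n / 2\<close>.
  For every \<open>\<mu>\<close> with \<open>1 < \<mu> < \<alpha> - 1\<close> the energy \<open>2 \<mu> W + S\<close>
  (\<open>W\<close> the weak, \<open>S\<close> the strong energy) eventually decreases by at least a multiple of \<open>n (|d\<^sub>n\<^sub>+\<^sub>1|\<^sup>2 + |v\<^sub>n\<^sub>+\<^sub>1|\<^sup>2)\<close>: monotonicity of \<open>M\<close>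
  and cocoercivity of \<open>C\<close> turn the leading terms into a quadratic form in
  \<open>v\<^sub>n\<^sub>+\<^sub>1 - v\<^sub>n\<close> and \<open>c\<^sub>n\<close> which is negative definite as soon as \<open>\<gamma> < 2 \<beta>\<close>.
  Since the energy is affine in \<open>\<mu>\<close>, two values of \<open>\<mu>\<close> show that \<open>W\<close> and \<open>S\<close>
  converge separately. As \<open>S\<^sub>n / n\<close> is summable, \<open>S\<close> tends to zero, which gives the
  rates, and then the limit of \<open>W\<close> is that of \<open>(\<alpha> - 1) |x\<^sub>n|\<^sup>2\<close>.

  Weak convergence follows because the forward-backward map \<open>T\<close> is nonexpansive, its
  fixed points are zeros, and \<open>z\<^sub>n - T z\<^sub>n\<close> tends to zero: along every filter finer than
  \<open>sequentially\<close> the asymptotic center of \<open>z\<close> is a fixed point of \<open>T\<close>, and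
  convergence of the distances to all fixed points forces these centers to coincide.
\<close>

section \<open>Minty's theorem and resolvents\<close>

text \<open>The set \<open>S\<close> plays the epigraph of a closed convex function, so that
  semicontinuity is closedness and infinite values never occur. The quadratic term makes the
  minimizing sequence Cauchy in its first component (\<open>mid\<close>); the quadratic growth comes
  from moving a small step \<open>h\<close> from the minimizer towards
  \<open>(q, \<tau>)\<close>.\<close>

lemma strongly_convex_minimizer:
  fixes S :: "('a::{real_inner, complete_space} \<times> real) set"
  assumes "closed S" "convex S" "S \<noteq> {}"
    and bdd: "\<And>p t. (p, t) \<in> S \<Longrightarrow> m \<le> t + (norm p)\<^sup>2 / 2"
  obtains p t where "(p, t) \<in> S"
    "\<And>q \<tau>. (q, \<tau>) \<in> S \<Longrightarrow> t + (norm p)\<^sup>2 / 2 + (norm (q - p))\<^sup>2 / 2 \<le> \<tau> + (norm q)\<^sup>2 / 2"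
proof -
  define f where "f = (\<lambda>s::'a \<times> real. snd s + (norm (fst s))\<^sup>2 / 2)"
  define I where "I = Inf (f ` S)"
  have bb: "bdd_below (f ` S)"
  proof (rule bdd_belowI2)
    fix s assume "s \<in> S"
    then show "m \<le> f s" using bdd[of "fst s" "snd s"] by (simp add: f_def)
  qed
  have I_le: "I \<le> f s" if "s \<in> S" for s
    unfolding I_def using bb that by (rule cINF_lower)
  have gap: "(1 - h) * f s + h * f s' - h * (1 - h) * (norm (fst s - fst s'))\<^sup>2 / 2
      = f ((1 - h) *\<^sub>R s + h *\<^sub>R s')" for s s' h
    unfolding f_def power2_norm_eq_inner
    by (simp add: inner_simps inner_commute[of "fst s'" "fst s"]) (simp add: field_simps)
  have conv: "(1 - h) *\<^sub>R s + h *\<^sub>R s' \<in> S" if "s \<in> S" "s' \<in> S" "0 \<le> h" "h \<le> 1" for s s' h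
    using assms(2) that by (simp add: convex_alt)
  have "\<exists>s\<in>S. f s < I + 1 / real (Suc n)" for n
    using cINF_less_iff[OF assms(3) bb, of "I + 1 / real (Suc n)"] by (simp add: I_def)
  then obtain s where sS: "\<And>n. s n \<in> S" and sI: "\<And>n. f (s n) < I + 1 / real (Suc n)"
    by metis
  have fs_lim: "(\<lambda>n. f (s n)) \<longlonglongrightarrow> I"
  proof (rule tendsto_sandwich[of "\<lambda>_. I" _ _ "\<lambda>n. I + 1 / real (Suc n)"])
    show "(\<lambda>n. I + 1 / real (Suc n)) \<longlonglongrightarrow> I"
      using tendsto_add[OF tendsto_const[of I] LIMSEQ_Suc[OF lim_1_over_n]] by simp
  qed (use I_le sS sI in \<open>auto intro!: always_eventually simp: less_imp_le\<close>)
  have mid: "(norm (fst (s i) - fst (s j)))\<^sup>2 < 4 * (1 / real (Suc i) + 1 / real (Suc j))" for i j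
  proof -
    have "I \<le> f ((1 - 1/2) *\<^sub>R s i + (1/2) *\<^sub>R s j)"
      by (intro I_le conv sS) auto
    also have "\<dots> = f (s i) / 2 + f (s j) / 2 - (norm (fst (s i) - fst (s j)))\<^sup>2 / 8"
      by (subst gap[symmetric]) (simp add: field_simps)
    finally have *: "I \<le> \<dots>" .
    have "I \<le> A / 2 + B / 2 - D / 8 \<Longrightarrow> A < I + a \<Longrightarrow> B < I + b \<Longrightarrow> D < 4 * (a + b)" for A B D a b
      by argo
    from this[OF * sI sI] show ?thesis .
  qed
  have "Cauchy (\<lambda>n. fst (s n))"
  proof (rule metric_CauchyI)
    fix e :: real assume "e > 0"
    then obtain N where N: "inverse (real (Suc N)) < e\<^sup>2 / 8"
      using reals_Archimedean[of "e\<^sup>2 / 8"] by auto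
    have "dist (fst (s i)) (fst (s j)) < e" if "i \<ge> N" "j \<ge> N" for i j
    proof -
      have "1 / real (Suc i) \<le> 1 / real (Suc N)" "1 / real (Suc j) \<le> 1 / real (Suc N)"
        using that by (auto simp: frac_le)
      then have "(norm (fst (s i) - fst (s j)))\<^sup>2 < e\<^sup>2"
        using mid[of i j] N by (simp add: inverse_eq_divide)
      then show ?thesis
        using \<open>e > 0\<close> by (simp add: dist_norm power_less_imp_less_base)
    qed
    then show "\<exists>N. \<forall>i\<ge>N. \<forall>j\<ge>N. dist (fst (s i)) (fst (s j)) < e" by blast
  qed
  then obtain p where p: "(\<lambda>n. fst (s n)) \<longlonglongrightarrow> p"
    by (auto simp: Cauchy_convergent_iff convergent_def)
  \<comment> \<open>The second component is the objective minus the quadratic term, so it converges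
    too, and closedness of \<open>S\<close> captures the limit pair.\<close>
  have "(\<lambda>n. f (s n) - (norm (fst (s n)))\<^sup>2 / 2) \<longlonglongrightarrow> I - (norm p)\<^sup>2 / 2"
    by (intro tendsto_intros fs_lim p) simp
  then have t: "(\<lambda>n. snd (s n)) \<longlonglongrightarrow> I - (norm p)\<^sup>2 / 2"
    by (simp add: f_def)
  define t where "t = I - (norm p)\<^sup>2 / 2"
  have "s \<longlonglongrightarrow> (p, t)"
    using tendsto_Pair[OF p t] by (simp add: t_def)
  then have ptS: "(p, t) \<in> S"
    using assms(1) sS by (auto simp: closed_sequential_limits)
  have fpt: "f (p, t) = I" by (simp add: f_def t_def)
  have "f (p, t) + (norm (q - p))\<^sup>2 / 2 \<le> f (q, \<tau>)" if q: "(q, \<tau>) \<in> S" for q \<tau>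
  proof (rule ccontr)
    define D where "D = (norm (q - p))\<^sup>2 / 2"
    assume "\<not> ?thesis"
    then have neg: "f (q, \<tau>) - I - D < 0" by (simp add: fpt D_def)
    have D0: "D \<ge> 0" by (simp add: D_def)
    \<comment> \<open>Minimality is tested on the segment and divided by \<open>h\<close>; letting
      \<open>h\<close> tend to zero removes the term \<open>h * D\<close>.\<close>
    have key: "0 \<le> f (q, \<tau>) - I - D + h * D" if h: "0 < h" "h \<le> 1" for h
    proof -
      have "I \<le> f ((1 - h) *\<^sub>R (p, t) + h *\<^sub>R (q, \<tau>))"
        using h by (intro I_le conv ptS q) auto
      also have "\<dots> = (1 - h) * I + h * f (q, \<tau>) - h * (1 - h) * D"
        using gap[of h "(p, t)" "(q, \<tau>)"] by (simp add: fpt D_def norm_minus_commute)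
      finally have "0 \<le> h * (f (q, \<tau>) - I - D + h * D)"
        by (simp add: algebra_simps)
      then show ?thesis using h by (simp add: zero_le_mult_iff)
    qed
    have lim: "((\<lambda>h. f (q, \<tau>) - I - D + h * D) \<longlongrightarrow> f (q, \<tau>) - I - D + 0 * D) (at_right 0)"
      by (intro tendsto_intros)
    have ev: "\<forall>\<^sub>F h in at_right 0. 0 \<le> f (q, \<tau>) - I - D + h * D"
      using eventually_at_right_less[of "0::real"] eventually_at_right_real[of 0 1]
      by (auto intro!: key elim: eventually_elim2)
    have "0 \<le> f (q, \<tau>) - I - D + 0 * D"
      using tendsto_lowerbound[OF lim ev] by simp
    then show False using neg by simp
  qed
  then show thesis
    using that[OF ptS] by (simp add: f_def)
qed

text \<open>The epigraph \<open>S\<close> of the Fitzpatrick function of \<open>G\<close> lies above the pairing, so \<open>t + (norm p)\<^sup>2 / 2\<close>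
  is nonnegative on it; if \<open>(a, b)\<close> is the minimizer, maximality puts \<open>(- b, - a)\<close> in \<open>G\<close> and then
  \<open>a + b = 0\<close>.\<close>

lemma minty_graph:
  fixes G :: "('a::{real_inner, complete_space} \<times> 'a) set"
  assumes mono: "\<And>x u y v. (x, u) \<in> G \<Longrightarrow> (y, v) \<in> G \<Longrightarrow> 0 \<le> (u - v) \<bullet> (x - y)"
    and maximal: "\<And>x u. (\<And>y v. (y, v) \<in> G \<Longrightarrow> 0 \<le> (u - v) \<bullet> (x - y)) \<Longrightarrow> (x, u) \<in> G"
  shows "\<exists>p. (p, - p) \<in> G"
proof -
  define S where "S = {((x, u), t :: real) |x u t. \<forall>(y, v)\<in>G. x \<bullet> v + y \<bullet> u - y \<bullet> v \<le> t}"
  have S_eq: "S = (\<Inter>(y, v)\<in>G. {s. fst (fst s) \<bullet> v + y \<bullet> snd (fst s) - y \<bullet> v \<le> snd s})"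
    unfolding S_def by fastforce
  have "closed S"
    unfolding S_eq by (intro closed_INT ballI) (auto split: prod.split intro!: closed_Collect_le continuous_intros)
  moreover have "convex S"
  proof (rule convexI)
    fix s s' :: "('a \<times> 'a) \<times> real" and a b :: real
    assume s: "s \<in> S" "s' \<in> S" and ab: "0 \<le> a" "0 \<le> b" "a + b = 1"
    have "(a *\<^sub>R fst (fst s) + b *\<^sub>R fst (fst s')) \<bullet> v + y \<bullet> (a *\<^sub>R snd (fst s) + b *\<^sub>R snd (fst s')) - y \<bullet> v
        \<le> a * snd s + b * snd s'" if "(y, v) \<in> G" for y v
    proof -
      have 1: "a * (fst (fst s) \<bullet> v + y \<bullet> snd (fst s) - y \<bullet> v) \<le> a * snd s"
        "b * (fst (fst s') \<bullet> v + y \<bullet> snd (fst s') - y \<bullet> v) \<le> b * snd s'"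
        using s that ab unfolding S_eq by (fastforce intro!: mult_left_mono)+
      have 2: "y \<bullet> v = a * (y \<bullet> v) + b * (y \<bullet> v)"
        using ab by (metis distrib_right mult_1)
      show ?thesis
        using add_mono[OF 1] by (subst 2) (simp add: inner_simps algebra_simps)
    qed
    then show "a *\<^sub>R s + b *\<^sub>R s' \<in> S" unfolding S_eq by auto
  qed
  moreover have "G \<noteq> {}" using maximal[of 0 0] by blast
  then obtain y0 v0 where "(y0, v0) \<in> G" by auto
  have G_S: "((x, u), x \<bullet> u) \<in> S" if "(x, u) \<in> G" for x u
  proof -
    have "x \<bullet> v + y \<bullet> u - y \<bullet> v \<le> x \<bullet> u" if "(y, v) \<in> G" for y v
      using mono[OF \<open>(x, u) \<in> G\<close> that] by (simp add: inner_simps inner_commute)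
    then show ?thesis by (auto simp: S_def)
  qed
  then have "S \<noteq> {}" using \<open>(y0, v0) \<in> G\<close> by blast
  \<comment> \<open>If the pairing exceeded \<open>t\<close>, then \<open>(x, u)\<close> would be
    monotonically related to all of \<open>G\<close>, hence lie in \<open>G\<close>; the constraint
    of \<open>S\<close> at \<open>(x, u)\<close> itself then bounds the pairing by
    \<open>t\<close>.\<close>
  moreover have above: "x \<bullet> u \<le> t" if "((x, u), t) \<in> S" for x u t
  proof (rule ccontr)
    assume less: "\<not> x \<bullet> u \<le> t"
    have le: "x \<bullet> v + y \<bullet> u - y \<bullet> v \<le> t" if "(y, v) \<in> G" for y v
      using \<open>((x, u), t) \<in> S\<close> that by (auto simp: S_def)
    have "(x, u) \<in> G"
      using le less by (intro maximal) (force simp: inner_simps inner_commute)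
    from le[OF this] less show False by simp
  qed
  have norm_pair: "(norm (x, u))\<^sup>2 = x \<bullet> x + u \<bullet> u" for x u :: 'a
    by (simp add: power2_norm_eq_inner)
  have "0 \<le> t + (norm p)\<^sup>2 / 2" if "(p, t) \<in> S" for p t
  proof (cases p)
    case (Pair x u)
    have "0 \<le> (x + u) \<bullet> (x + u)" by simp
    then have "0 \<le> 2 * (x \<bullet> u) + (x \<bullet> x + u \<bullet> u)"
      by (simp add: inner_simps inner_commute[of u x])
    moreover have "x \<bullet> u \<le> t" using above that Pair by simp
    ultimately have "0 \<le> t + (x \<bullet> x + u \<bullet> u) / 2" by (simp add: field_simps)
    then show ?thesis by (simp only: Pair norm_pair)
  qed
  ultimately obtain p t where pS: "(p, t) \<in> S"
    and min: "\<And>q \<tau>. (q, \<tau>) \<in> S \<Longrightarrow> t + (norm p)\<^sup>2 / 2 + (norm (q - p))\<^sup>2 / 2 \<le> \<tau> + (norm q)\<^sup>2 / 2"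
    by (rule strongly_convex_minimizer[of S 0]) (assumption | rule that)+
  obtain a b where p: "p = (a, b)" by (cases p)
  \<comment> \<open>The growth bound at the minimizer is tested at the graph point lifted by its
    pairing; after expansion the squares of \<open>x\<close> and \<open>u\<close> cancel. At
    \<open>(- b, - a)\<close> the right-hand side vanishes.\<close>
  have ineq: "(a + b) \<bullet> (a + b) \<le> (u + a) \<bullet> (x + b)" if "(x, u) \<in> G" for x u
  proof -
    have "t + (norm p)\<^sup>2 / 2 + (norm ((x, u) - p))\<^sup>2 / 2 \<le> x \<bullet> u + (norm (x, u))\<^sup>2 / 2"
      by (rule min[OF G_S[OF that]])
    then have "2 * t + (norm (a, b))\<^sup>2 + (norm (x - a, u - b))\<^sup>2 \<le> 2 * (x \<bullet> u) + (norm (x, u))\<^sup>2"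
      by (simp add: p)
    moreover have "a \<bullet> b \<le> t" using above pS by (simp add: p)
    ultimately show ?thesis unfolding norm_pair
      by (simp add: inner_simps inner_commute[of b a] inner_commute[of a x] inner_commute[of b u]
          inner_commute[of u x])
  qed
  have G: "(- b, - a) \<in> G"
  proof (rule maximal)
    fix y v assume "(y, v) \<in> G"
    have "0 \<le> (v + a) \<bullet> (y + b)"
      using ineq[OF \<open>(y, v) \<in> G\<close>] inner_ge_zero[of "a + b"] by linarith
    then show "0 \<le> (- a - v) \<bullet> (- b - y)"
      by (simp add: inner_simps inner_commute)
  qed
  have "(a + b) \<bullet> (a + b) \<le> 0" using ineq[OF G] by simp
  then have "a + b = 0" by (metis inner_ge_zero inner_eq_zero_iff order_antisym)
  then have "- a = - (- b)" by (simp add: add_eq_0_iff)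
  then show ?thesis using G by metis
qed

text \<open>Adjoining \<open>u\<close> to the values at \<open>x\<close> keeps the operator
  monotone, so maximality forces equality. This is the pointwise form of maximality that
  \<open>minty_graph\<close> expects.\<close>

lemma maximally_monotone_memI:
  assumes "maximally_monotone M" and rel: "\<And>y v. v \<in> M y \<Longrightarrow> 0 \<le> (u - v) \<bullet> (x - y)"
  shows "u \<in> M x"
proof -
  define N where "N = M(x := insert u (M x))"
  have M: "monotone_operator M" using assms(1) by (simp add: maximally_monotone_def)
  have "0 \<le> (u1 - u2) \<bullet> (x1 - x2)" if "u1 \<in> N x1" "u2 \<in> N x2" for x1 x2 u1 u2
  proof -
    have sym: "(v - u) \<bullet> (y - x) = (u - v) \<bullet> (x - y)" for v y
      by (simp add: inner_simps)
    show ?thesis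
      using that M rel[of u1 x1] rel[of u2 x2]
      by (auto simp: N_def monotone_operator_def sym split: if_splits)
  qed
  then have "monotone_operator N" by (simp add: monotone_operator_def)
  moreover have "\<forall>y. M y \<subseteq> N y" by (auto simp: N_def)
  ultimately have "N = M" using assms(1) by (auto simp: maximally_monotone_def)
  then show ?thesis by (metis N_def fun_upd_same insertI1)
qed

text \<open>The graph of \<gamma>M - x inherits monotonicity and maximality, and a point
  \<open>(p, - p)\<close> on it is a solution of the inclusion.\<close>

lemma maximally_monotone_resolvent_exists:
  fixes M :: "'a::{real_inner, complete_space} \<Rightarrow> 'a set"
  assumes "maximally_monotone M" "\<gamma> > 0"
  shows "\<exists>p. \<exists>u\<in>M p. x = p + \<gamma> *\<^sub>R u"
proof -
  define G where "G = {(p, \<gamma> *\<^sub>R u - x) |p u. u \<in> M p}"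
  have mono: "monotone_operator M" using assms(1) by (simp add: maximally_monotone_def)
  have "\<exists>p. (p, - p) \<in> G"
  proof (rule minty_graph)
    fix p u q v assume "(p, u) \<in> G" "(q, v) \<in> G"
    then obtain u' v' where *: "u = \<gamma> *\<^sub>R u' - x" "v = \<gamma> *\<^sub>R v' - x" "u' \<in> M p" "v' \<in> M q"
      by (auto simp: G_def)
    have "0 \<le> \<gamma> * ((u' - v') \<bullet> (p - q))"
      using mono * assms(2) by (simp add: monotone_operator_def)
    also have "\<dots> = (u - v) \<bullet> (p - q)" by (simp add: * inner_simps algebra_simps)
    finally show "0 \<le> (u - v) \<bullet> (p - q)" .
  next
    fix p u assume rel: "\<And>y v. (y, v) \<in> G \<Longrightarrow> 0 \<le> (u - v) \<bullet> (p - y)"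
    have "(1 / \<gamma>) *\<^sub>R (u + x) \<in> M p"
    proof (rule maximally_monotone_memI[OF assms(1)])
      fix y v assume "v \<in> M y"
      then have "0 \<le> (u - (\<gamma> *\<^sub>R v - x)) \<bullet> (p - y)" by (intro rel) (auto simp: G_def)
      also have "u - (\<gamma> *\<^sub>R v - x) = \<gamma> *\<^sub>R ((1 / \<gamma>) *\<^sub>R (u + x) - v)"
        using assms(2) by (simp add: algebra_simps)
      finally show "0 \<le> ((1 / \<gamma>) *\<^sub>R (u + x) - v) \<bullet> (p - y)"
        using assms(2) by (simp add: zero_le_mult_iff)
    qed
    then show "(p, u) \<in> G"
      using assms(2) by (auto simp: G_def intro!: exI[of _ "(1 / \<gamma>) *\<^sub>R (u + x)"])
  qed
  then obtain p u where "u \<in> M p" "- p = \<gamma> *\<^sub>R u - x" by (auto simp: G_def)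
  then show ?thesis by (auto intro!: exI[of _ p] bexI[of _ u] simp: algebra_simps)
qed

section \<open>Single-valuedness and nonexpansiveness of the resolvent\<close>

lemma monotone_resolvent_nonexpansive:
  assumes "monotone_operator M" "\<gamma> > 0" "u \<in> M p" "v \<in> M q"
  shows "norm (p - q) \<le> norm ((p + \<gamma> *\<^sub>R u) - (q + \<gamma> *\<^sub>R v))"
proof -
  have "0 \<le> \<gamma> * ((u - v) \<bullet> (p - q))"
    using assms by (simp add: monotone_operator_def)
  then have "(norm (p - q))\<^sup>2 \<le> ((p + \<gamma> *\<^sub>R u) - (q + \<gamma> *\<^sub>R v)) \<bullet> (p - q)"
    by (simp add: power2_norm_eq_inner inner_simps algebra_simps)
  also have "\<dots> \<le> norm ((p + \<gamma> *\<^sub>R u) - (q + \<gamma> *\<^sub>R v)) * norm (p - q)"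
    by (rule norm_cauchy_schwarz)
  finally show ?thesis
    by (cases "norm (p - q) = 0") (auto simp: power2_eq_square)
qed

lemma resolvent_eqI:
  assumes "monotone_operator M" "\<gamma> > 0" "u \<in> M p"
  shows "resolvent \<gamma> M (p + \<gamma> *\<^sub>R u) = p"
  unfolding resolvent_def
proof (rule the_equality)
  show "p \<in> resolvent_set \<gamma> M (p + \<gamma> *\<^sub>R u)"
    using assms(3) by (auto simp: resolvent_set_def)
next
  fix q assume "q \<in> resolvent_set \<gamma> M (p + \<gamma> *\<^sub>R u)"
  then obtain v where "v \<in> M q" "p + \<gamma> *\<^sub>R u = q + \<gamma> *\<^sub>R v"
    by (auto simp: resolvent_set_def)
  then show "q = p"
    using monotone_resolvent_nonexpansive[OF assms(1,2), of v q u p] assms(3) by simp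
qed

lemma resolvent_mem:
  fixes M :: "'a::{real_inner, complete_space} \<Rightarrow> 'a set"
  assumes "maximally_monotone M" "\<gamma> > 0"
  shows "(1 / \<gamma>) *\<^sub>R (x - resolvent \<gamma> M x) \<in> M (resolvent \<gamma> M x)"
proof -
  obtain p u where "u \<in> M p" "x = p + \<gamma> *\<^sub>R u"
    using maximally_monotone_resolvent_exists[OF assms] by blast
  moreover from this have "resolvent \<gamma> M x = p"
    using resolvent_eqI assms by (auto simp: maximally_monotone_def)
  ultimately show ?thesis using assms(2) by simp
qed

lemma resolvent_nonexpansive:
  fixes M :: "'a::{real_inner, complete_space} \<Rightarrow> 'a set"
  assumes "maximally_monotone M" "\<gamma> > 0"
  shows "norm (resolvent \<gamma> M x - resolvent \<gamma> M y) \<le> norm (x - y)"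
proof -
  have "monotone_operator M" using assms(1) by (simp add: maximally_monotone_def)
  from monotone_resolvent_nonexpansive[OF this assms(2) resolvent_mem[OF assms, of x]
      resolvent_mem[OF assms, of y]]
  show ?thesis using assms(2) by simp
qed

section \<open>Asymptotic centers and weak convergence\<close>

text \<open>Here \<open>r\<close> is the limit superior of the squared distances to \<open>c\<close>
  along \<open>F\<close>, expressed through eventual bounds. The second clause says that
  \<open>c\<close> minimizes this limit superior, with quadratic growth. Filters take the place of
  subsequences.\<close>

definition asymptotic_center :: "'i filter \<Rightarrow> ('i \<Rightarrow> 'a::real_inner) \<Rightarrow> 'a \<Rightarrow> real \<Rightarrow> bool" where
  "asymptotic_center F z c r \<longleftrightarrow>
     (\<forall>e>0. \<forall>\<^sub>F n in F. (norm (z n - c))\<^sup>2 \<le> r + e) \<and>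
     (\<forall>v \<rho>. (\<forall>e>0. \<forall>\<^sub>F n in F. (norm (z n - v))\<^sup>2 \<le> \<rho> + e) \<longrightarrow> r + (norm (v - c))\<^sup>2 \<le> \<rho>)"

text \<open>Half the squared distance to \<open>v\<close> is half the squared norm of
  \<open>v\<close> plus a function affine in \<open>v\<close>. The limit superior of the affine
  parts is convex in \<open>v\<close>, and \<open>S\<close> is its epigraph, so
  \<open>strongly_convex_minimizer\<close> applies.\<close>

lemma asymptotic_center_exists:
  fixes z :: "'i \<Rightarrow> 'a::{real_inner, complete_space}"
  assumes "F \<noteq> bot" and bdd: "\<And>n. norm (z n) \<le> B"
  shows "\<exists>c r. asymptotic_center F z c r"
proof -
  define S where "S = {(v, t). \<forall>e>0. \<forall>\<^sub>F n in F. (norm (z n))\<^sup>2 / 2 - z n \<bullet> v \<le> t + e}"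
  have eq: "(norm (z n))\<^sup>2 / 2 - z n \<bullet> v = (norm (z n - v))\<^sup>2 / 2 - (norm v)\<^sup>2 / 2" for n v
    by (simp add: power2_norm_eq_inner inner_simps inner_commute field_simps)
  have B: "0 \<le> B" using bdd[of undefined] norm_ge_zero order_trans by blast
  have "closed S"
  proof (subst closed_sequential_limits, safe)
    fix s v t assume s: "\<forall>n. s n \<in> S" and lim: "s \<longlonglongrightarrow> (v, t)"
    show "(v, t) \<in> S" unfolding S_def
    proof clarify
      fix e :: real assume e: "e > 0"
      \<comment> \<open>Boundedness of \<open>z\<close> makes the dependence on \<open>v\<close>
        uniform in \<open>n\<close>, so one index \<open>k\<close> serves all \<open>n\<close> at
        once.\<close>
      have "(\<lambda>k. B * norm (fst (s k) - v) + \<bar>snd (s k) - t\<bar>) \<longlonglongrightarrow> B * norm (v - v) + \<bar>t - t\<bar>"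
        using tendsto_fst[OF lim] tendsto_snd[OF lim] by (intro tendsto_intros) auto
      then have "\<forall>\<^sub>F k in sequentially. B * norm (fst (s k) - v) + \<bar>snd (s k) - t\<bar> < e / 2"
        using e by (intro order_tendstoD) auto
      then obtain k where k: "B * norm (fst (s k) - v) + \<bar>snd (s k) - t\<bar> < e / 2"
        by (auto simp: eventually_sequentially)
      have "\<forall>\<^sub>F n in F. (norm (z n))\<^sup>2 / 2 - z n \<bullet> fst (s k) \<le> snd (s k) + e / 2"
        using s e unfolding S_def by (auto simp: case_prod_beta)
      then show "\<forall>\<^sub>F n in F. (norm (z n))\<^sup>2 / 2 - z n \<bullet> v \<le> t + e"
      proof eventually_elim
        case (elim n)
        have "z n \<bullet> (fst (s k) - v) \<le> norm (z n) * norm (fst (s k) - v)"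
          by (rule norm_cauchy_schwarz)
        also have "\<dots> \<le> B * norm (fst (s k) - v)"
          by (intro mult_right_mono bdd) auto
        finally have "z n \<bullet> fst (s k) - z n \<bullet> v \<le> B * norm (fst (s k) - v)"
          by (simp add: inner_diff_right)
        then show ?case using elim k abs_ge_self[of "snd (s k) - t"] by linarith
      qed
    qed
  qed
  moreover have "convex S"
  proof (rule convexI)
    fix s s' :: "'a \<times> real" and a b :: real
    assume s: "s \<in> S" "s' \<in> S" and ab: "0 \<le> a" "0 \<le> b" "a + b = 1"
    have ab1: "a * x + b * x = x" for x
      using ab(3) by (metis distrib_right mult_1)
    have "\<forall>\<^sub>F n in F. (norm (z n))\<^sup>2 / 2 - z n \<bullet> (a *\<^sub>R fst s + b *\<^sub>R fst s')
        \<le> a * snd s + b * snd s' + e" if "e > 0" for e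
    proof -
      have "\<forall>\<^sub>F n in F. (norm (z n))\<^sup>2 / 2 - z n \<bullet> fst s \<le> snd s + e"
        "\<forall>\<^sub>F n in F. (norm (z n))\<^sup>2 / 2 - z n \<bullet> fst s' \<le> snd s' + e"
        using s that by (auto simp: S_def)
      then show ?thesis
      proof eventually_elim
        case (elim n)
        have "(norm (z n))\<^sup>2 / 2 - z n \<bullet> (a *\<^sub>R fst s + b *\<^sub>R fst s')
          = a * ((norm (z n))\<^sup>2 / 2 - z n \<bullet> fst s) + b * ((norm (z n))\<^sup>2 / 2 - z n \<bullet> fst s')"
          using ab1[of "(norm (z n))\<^sup>2 / 2"] by (simp add: inner_simps right_diff_distrib)
        also have "\<dots> \<le> a * (snd s + e) + b * (snd s' + e)"
          using elim ab by (intro add_mono mult_left_mono) auto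
        also have "\<dots> = a * snd s + b * snd s' + e"
          using ab1[of e] by (simp add: distrib_left)
        finally show ?case .
      qed
    qed
    then show "a *\<^sub>R s + b *\<^sub>R s' \<in> S"
      by (simp add: S_def case_prod_beta)
  qed
  moreover have "(0, B\<^sup>2 / 2) \<in> S"
    using bdd by (auto simp: S_def intro!: always_eventually add_increasing2 power_mono)
  then have "S \<noteq> {}" by blast
  moreover have "0 \<le> t + (norm v)\<^sup>2 / 2" if "(v, t) \<in> S" for v t
  proof (rule field_le_epsilon)
    fix e :: real assume "e > 0"
    then have "\<forall>\<^sub>F n in F. (norm (z n))\<^sup>2 / 2 - z n \<bullet> v \<le> t + e"
      using that by (auto simp: S_def)
    then obtain n where "(norm (z n))\<^sup>2 / 2 - z n \<bullet> v \<le> t + e"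
      using assms(1) eventually_happens' by blast
    then have "(norm (z n - v))\<^sup>2 / 2 - (norm v)\<^sup>2 / 2 \<le> t + e" by (simp only: eq)
    then show "0 \<le> t + (norm v)\<^sup>2 / 2 + e"
      using zero_le_power2[of "norm (z n - v)"] by linarith
  qed
  ultimately obtain c t where cS: "(c, t) \<in> S"
    and min: "\<And>v \<tau>. (v, \<tau>) \<in> S \<Longrightarrow> t + (norm c)\<^sup>2 / 2 + (norm (v - c))\<^sup>2 / 2 \<le> \<tau> + (norm v)\<^sup>2 / 2"
    by (rule strongly_convex_minimizer[of S 0]) (assumption | rule that)+
  \<comment> \<open>The minimal value is half the limit superior of the squared distances, which
    explains the radius.\<close>
  have "asymptotic_center F z c (2 * t + (norm c)\<^sup>2)"
    unfolding asymptotic_center_def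
  proof (intro conjI allI impI)
    fix e :: real assume "e > 0"
    then have "\<forall>\<^sub>F n in F. (norm (z n))\<^sup>2 / 2 - z n \<bullet> c \<le> t + e / 2"
      using cS by (auto simp: S_def)
    then show "\<forall>\<^sub>F n in F. (norm (z n - c))\<^sup>2 \<le> (2 * t + (norm c)\<^sup>2) + e"
      by eventually_elim (simp add: eq)
  next
    fix v \<rho> assume *: "\<forall>e>0. \<forall>\<^sub>F n in F. (norm (z n - v))\<^sup>2 \<le> \<rho> + e"
    have "(v, \<rho> / 2 - (norm v)\<^sup>2 / 2) \<in> S" unfolding S_def
    proof clarify
      fix e :: real assume "e > 0"
      then show "\<forall>\<^sub>F n in F. (norm (z n))\<^sup>2 / 2 - z n \<bullet> v \<le> \<rho> / 2 - (norm v)\<^sup>2 / 2 + e"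
        using *[rule_format, of "2 * e"] by (simp add: eq field_simps)
    qed
    from min[OF this] show "(2 * t + (norm c)\<^sup>2) + (norm (v - c))\<^sup>2 \<le> \<rho>"
      by (simp add: field_simps)
  qed
  then show ?thesis by blast
qed

lemma nonexpansive_opial:
  fixes z :: "nat \<Rightarrow> 'a::{real_inner, complete_space}"
  assumes nonexp: "\<And>x y. norm (T x - T y) \<le> norm (x - y)"
    and regular: "(\<lambda>n. z n - T (z n)) \<longlonglongrightarrow> 0"
    and fejer: "\<And>p. T p = p \<Longrightarrow> convergent (\<lambda>n. (norm (z n - p))\<^sup>2)"
    and bdd: "\<And>n. norm (z n) \<le> B"
  shows "\<exists>c. T c = c \<and> weakly_converges z c"
proof -
  have fix_center: "T c = c"
    if F: "F \<le> sequentially" and center: "asymptotic_center F z c r" for F c r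
  proof -
    note c = center[unfolded asymptotic_center_def, THEN conjunct1, rule_format]
    note min = center[unfolded asymptotic_center_def, THEN conjunct2, rule_format]
    \<comment> \<open>Asymptotically \<open>T c\<close> is no farther from \<open>z\<close> than
      \<open>c\<close>, because \<open>T\<close> is nonexpansive and moves \<open>z n\<close> by a
      vanishing amount; quadratic growth then leaves no room between them.\<close>
    have "r + (norm (T c - c))\<^sup>2 \<le> r"
    proof (rule min)
      fix e :: real assume e: "e > 0"
      define K where "K = B + norm c"
      have lim: "((\<lambda>n. (norm (z n - T (z n)))\<^sup>2 + 2 * norm (z n - T (z n)) * K) \<longlongrightarrow> (norm (0::'a))\<^sup>2 + 2 * norm (0::'a) * K) F"
        by (intro tendsto_intros tendsto_mono[OF F regular])
      have "\<forall>\<^sub>F n in F. (norm (z n - T (z n)))\<^sup>2 + 2 * norm (z n - T (z n)) * K < e / 2"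
        by (rule order_tendstoD(2)[OF lim]) (use e in simp)
      moreover have "\<forall>\<^sub>F n in F. (norm (z n - c))\<^sup>2 \<le> r + e / 2" using e by (intro c) simp
      ultimately show "\<forall>\<^sub>F n in F. (norm (z n - T c))\<^sup>2 \<le> r + e"
      proof eventually_elim
        case (elim n)
        have "norm (z n - T c) \<le> norm (z n - T (z n)) + norm (T (z n) - T c)"
          using norm_triangle_ineq[of "z n - T (z n)" "T (z n) - T c"] by simp
        also have "\<dots> \<le> norm (z n - T (z n)) + norm (z n - c)"
          using nonexp by simp
        finally have "(norm (z n - T c))\<^sup>2 \<le> (norm (z n - T (z n)) + norm (z n - c))\<^sup>2"
          by (intro power_mono) auto
        also have "\<dots> = (norm (z n - T (z n)))\<^sup>2 + 2 * norm (z n - T (z n)) * norm (z n - c) + (norm (z n - c))\<^sup>2"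
          by (simp add: power2_sum)
        also have "\<dots> \<le> (norm (z n - T (z n)))\<^sup>2 + 2 * norm (z n - T (z n)) * K + (norm (z n - c))\<^sup>2"
          using norm_triangle_ineq4[of "z n" c] bdd[of n]
          by (intro add_mono mult_left_mono) (auto simp: K_def)
        finally show ?case using elim by simp
      qed
    qed
    then show ?thesis by simp
  qed
  obtain c r where center: "asymptotic_center sequentially z c r"
    using asymptotic_center_exists[OF sequentially_bot, of z B] bdd by blast
  note c = center[unfolded asymptotic_center_def, THEN conjunct1, rule_format]
  note cmin = center[unfolded asymptotic_center_def, THEN conjunct2, rule_format]
  have Tc: "T c = c" by (rule fix_center[OF order_refl center])
  obtain a where a: "(\<lambda>n. (norm (z n - c))\<^sup>2) \<longlonglongrightarrow> a"
    using fejer[OF Tc] by (auto simp: convergent_def)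
  have ev_le: "\<forall>\<^sub>F n in F. f n \<le> l + e" if "(f \<longlongrightarrow> l) F" "e > 0" for F and f :: "nat \<Rightarrow> real" and l e
    using order_tendstoD(2)[OF that(1), of "l + e"] that(2) by (auto elim: eventually_mono)
  have le_r: "l \<le> r'" if "(f \<longlongrightarrow> l) F" "F \<noteq> bot" "\<And>e. e > 0 \<Longrightarrow> \<forall>\<^sub>F n in F. f n \<le> r' + e"
    for F and f :: "nat \<Rightarrow> real" and l r'
    by (rule field_le_epsilon) (rule tendsto_upperbound[OF that(1) that(3) that(2)])
  have ar: "a \<le> r" by (rule le_r[OF a sequentially_bot c])
  have no_ev: "\<not> (\<exists>\<^sub>F n in sequentially. e \<le> (z n - c) \<bullet> v)" if e: "e > 0" for e v
  proof
    assume freq: "\<exists>\<^sub>F n in sequentially. e \<le> (z n - c) \<bullet> v"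
    \<comment> \<open>If weak convergence fails in direction \<open>v\<close>, the offending indices
      generate a proper filter finer than \<open>sequentially\<close>.\<close>
    define F where "F = inf sequentially (principal {n. e \<le> (z n - c) \<bullet> v})"
    have F: "F \<le> sequentially" by (simp add: F_def)
    have Fbot: "F \<noteq> bot"
      using freq by (auto simp: F_def trivial_limit_def eventually_inf_principal frequently_def)
    have evF: "\<forall>\<^sub>F n in F. e \<le> (z n - c) \<bullet> v"
      by (simp add: F_def eventually_inf_principal)
    obtain c' r' where center': "asymptotic_center F z c' r'"
      using asymptotic_center_exists[OF Fbot, of z B] bdd by blast
    note c' = center'[unfolded asymptotic_center_def, THEN conjunct1, rule_format]
    note cmin' = center'[unfolded asymptotic_center_def, THEN conjunct2, rule_format]
    have Tc': "T c' = c'" by (rule fix_center[OF F center'])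
    obtain a' where a': "(\<lambda>n. (norm (z n - c'))\<^sup>2) \<longlonglongrightarrow> a'"
      using fejer[OF Tc'] by (auto simp: convergent_def)
    \<comment> \<open>Both centers are fixed points, so the distances to each converge along the
      whole sequence. Each growth bound is tested at the other center; in the sum the radii cancel
      and only the distance between the centers remains.\<close>
    have "r + (norm (c' - c))\<^sup>2 \<le> a'" by (rule cmin) (rule ev_le[OF a'])
    moreover have "r' + (norm (c - c'))\<^sup>2 \<le> a"
      by (rule cmin') (rule ev_le[OF tendsto_mono[OF F a]])
    moreover have "a' \<le> r'" by (rule le_r[OF tendsto_mono[OF F a'] Fbot c'])
    ultimately have "(norm (c' - c))\<^sup>2 + (norm (c - c'))\<^sup>2 \<le> 0" using ar by linarith
    then have "(norm (c' - c))\<^sup>2 = 0"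
      using zero_le_power2[of "norm (c' - c)"] zero_le_power2[of "norm (c - c')"] by linarith
    then have cc: "c' = c" by simp
    have v0: "v \<noteq> 0"
      using evF e eventually_happens'[OF Fbot] by fastforce
    \<comment> \<open>Shifting the center by \<open>t\<close> along \<open>v\<close> lowers the
      squared distances by \<open>2 * t * e\<close>, up to a quadratic term that also appears in the
      growth bound and cancels.\<close>
    define t where "t = e / (norm v)\<^sup>2"
    have t: "t > 0" using e v0 by (simp add: t_def)
    have "r' + (norm ((c + t *\<^sub>R v) - c'))\<^sup>2 \<le> r' - 2 * t * e + t\<^sup>2 * (norm v)\<^sup>2"
    proof (rule cmin')
      fix d :: real assume "d > 0"
      from c'[OF this] evF show "\<forall>\<^sub>F n in F. (norm (z n - (c + t *\<^sub>R v)))\<^sup>2 \<le> r' - 2 * t * e + t\<^sup>2 * (norm v)\<^sup>2 + d"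
      proof eventually_elim
        case (elim n)
        have "t * e \<le> t * ((z n - c) \<bullet> v)" using elim t by (intro mult_left_mono) auto
        moreover have "(norm (z n - (c + t *\<^sub>R v)))\<^sup>2
            = (norm (z n - c))\<^sup>2 - 2 * (t * ((z n - c) \<bullet> v)) + t\<^sup>2 * (norm v)\<^sup>2"
          unfolding power2_norm_eq_inner
          by (simp add: inner_simps inner_commute[of v c] inner_commute[of v "z n"] inner_commute[of c "z n"]
              algebra_simps power2_eq_square)
        ultimately show ?case using elim by (simp add: cc)
      qed
    qed
    then have "2 * t * e \<le> 0"
      by (simp add: cc power_mult_distrib)
    then show False using t e by (simp add: mult_le_0_iff)
  qed
  have "(\<lambda>n. z n \<bullet> v) \<longlonglongrightarrow> c \<bullet> v" for v
  proof (rule tendstoI)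
    fix e :: real assume e: "e > 0"
    have ev: "\<forall>\<^sub>F n in sequentially. \<not> e \<le> (z n - c) \<bullet> v" for v
      using no_ev[OF e] by (simp add: frequently_def)
    from ev[of v] ev[of "- v"] show "\<forall>\<^sub>F n in sequentially. dist (z n \<bullet> v) (c \<bullet> v) < e"
      by eventually_elim (simp add: dist_real_def inner_diff_left)
  qed
  with Tc show ?thesis by (auto simp: weakly_converges_def)
qed

section \<open>Lyapunov analysis of the recursion\<close>

definition weak_energy :: "real \<Rightarrow> real \<Rightarrow> real \<Rightarrow> 'a::real_inner \<Rightarrow> 'a \<Rightarrow> 'a \<Rightarrow> real" where
  "weak_energy \<alpha> \<gamma> t x d v =
     (\<alpha> - 1) * (x \<bullet> x) + 2 * t * (x \<bullet> d) + \<gamma> * (2 * t + \<alpha>) * (x \<bullet> v)"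

definition strong_energy :: "real \<Rightarrow> real \<Rightarrow> real \<Rightarrow> 'a::real_inner \<Rightarrow> 'a \<Rightarrow> real" where
  "strong_energy \<alpha> \<gamma> t d v =
     (norm (t *\<^sub>R (2 *\<^sub>R d + \<gamma> *\<^sub>R v)))\<^sup>2 / 2 + \<gamma>\<^sup>2 * (t + 1) * (t + \<alpha>) * (v \<bullet> v) / 2"

text \<open>Read with \<open>t\<close> as n: \<open>x\<close>, \<open>d\<close>, \<open>v\<close>
  belong to index n + 1, while \<open>x - d\<close>, \<open>d'\<close>, \<open>v - e\<close> are
  their predecessors. The hypothesis is the recursion solved for \<open>t\<close> times the old
  velocity; it is paired with \<open>x - d\<close>.\<close>

lemma weak_energy_step:
  assumes "t *\<^sub>R d' = (t + \<alpha>) *\<^sub>R d + (\<gamma> * (t + \<alpha> / 2)) *\<^sub>R e + (\<gamma> * \<alpha> / 2) *\<^sub>R v"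
  shows "weak_energy \<alpha> \<gamma> (t + 1) x d v - weak_energy \<alpha> \<gamma> t (x - d) d' (v - e)
    = - \<gamma> * (\<alpha> - 2) * (x \<bullet> v) + (2 * t + \<alpha> + 1) * (d \<bullet> d) + 2 * \<gamma> * (t + \<alpha>) * (d \<bullet> v)"
proof -
  have "t * ((x - d) \<bullet> d') = (x - d) \<bullet> (t *\<^sub>R d')" by simp
  also have "\<dots> = (t + \<alpha>) * (x \<bullet> d - d \<bullet> d) + \<gamma> * (t + \<alpha> / 2) * (x \<bullet> e - d \<bullet> e)
      + \<gamma> * \<alpha> / 2 * (x \<bullet> v - d \<bullet> v)"
    by (simp only: assms inner_simps)
  finally show ?thesis
    unfolding weak_energy_def
    by (simp add: inner_simps inner_commute[of v x] inner_commute[of d x] inner_commute[of d' x]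
        inner_commute[of d' d] inner_commute[of e x] inner_commute[of e d] inner_commute[of v d]
        field_simps)
qed

text \<open>The recursion turns the old vector
  \<open>t *\<^sub>R (2 *\<^sub>R d' + \<gamma> *\<^sub>R (v - e))\<close> into \<open>(t +
  \<alpha>) *\<^sub>R (2 *\<^sub>R d + \<gamma> *\<^sub>R (v + e))\<close>, so both energies become
  quadratic forms in the new data and \<open>e\<close>.\<close>

lemma strong_energy_step:
  assumes "t *\<^sub>R d' = (t + \<alpha>) *\<^sub>R d + (\<gamma> * (t + \<alpha> / 2)) *\<^sub>R e + (\<gamma> * \<alpha> / 2) *\<^sub>R v"
  shows "strong_energy \<alpha> \<gamma> (t + 1) d v - strong_energy \<alpha> \<gamma> t d' (v - e)
    = - 2 * (\<alpha> - 1) * (2 * t + \<alpha> + 1) * (d \<bullet> d)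
      - 2 * \<gamma> * (\<alpha> - 1) * (2 * t + \<alpha> + 1) * (d \<bullet> v)
      - \<gamma>\<^sup>2 / 2 * ((\<alpha> - 2) * (2 * t + \<alpha> + 1) - 1) * (v \<bullet> v)
      - 2 * \<gamma> * (t + \<alpha>)\<^sup>2 * (d \<bullet> e) - \<gamma>\<^sup>2 * (\<alpha> - 1) * (t + \<alpha>) * (v \<bullet> e)
      - \<gamma>\<^sup>2 / 2 * (t + \<alpha>) * (2 * t + \<alpha> + 1) * (e \<bullet> e)"
proof -
  have "t *\<^sub>R (2 *\<^sub>R d' + \<gamma> *\<^sub>R (v - e)) = 2 *\<^sub>R (t *\<^sub>R d') + (t * \<gamma>) *\<^sub>R (v - e)"
    by (simp add: algebra_simps)
  also have "\<dots> = (t + \<alpha>) *\<^sub>R (2 *\<^sub>R d + \<gamma> *\<^sub>R (v + e))"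
  proof -
    have "(\<gamma> * (t * 2)) *\<^sub>R e = (\<gamma> * t) *\<^sub>R e + (\<gamma> * t) *\<^sub>R e"
      by (simp flip: scaleR_left_distrib)
    then show ?thesis
      unfolding assms scaleR_add_right scaleR_diff_right
      by (simp add: algebra_simps)
  qed
  finally have eq: "(norm (t *\<^sub>R (2 *\<^sub>R d' + \<gamma> *\<^sub>R (v - e))))\<^sup>2
      = (t + \<alpha>)\<^sup>2 * ((2 *\<^sub>R d + \<gamma> *\<^sub>R (v + e)) \<bullet> (2 *\<^sub>R d + \<gamma> *\<^sub>R (v + e)))"
    by (simp add: power_mult_distrib power2_norm_eq_inner)
  show ?thesis
    unfolding strong_energy_def eq unfolding power2_norm_eq_inner
    by (simp add: inner_simps inner_commute[of v d] inner_commute[of e d] inner_commute[of e v])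
       (simp add: field_simps power2_eq_square)
qed

text \<open>Completing the square shows that for \<mu> between 0 and \<alpha> - 1 only the product
  of \<open>x\<close> and \<open>v\<close> can make the combined energy negative.\<close>

lemma energy_eq:
  "2 * \<mu> * weak_energy \<alpha> \<gamma> t x d v + strong_energy \<alpha> \<gamma> t d v
    = (norm ((2 * \<mu>) *\<^sub>R x + t *\<^sub>R (2 *\<^sub>R d + \<gamma> *\<^sub>R v)))\<^sup>2 / 2 + 2 * \<mu> * (\<alpha> - 1 - \<mu>) * (norm x)\<^sup>2
      + 2 * \<mu> * \<gamma> * (t + \<alpha>) * (x \<bullet> v) + \<gamma>\<^sup>2 * (t + 1) * (t + \<alpha>) * (norm v)\<^sup>2 / 2"
  unfolding weak_energy_def strong_energy_def power2_norm_eq_inner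
  by (simp add: inner_simps inner_commute[of v x] inner_commute[of d x] inner_commute[of v d])
     (simp add: field_simps power2_eq_square)

section \<open>Auxiliary facts on quadratic forms and sequences\<close>

lemma eventually_quadratic_form_ge:
  fixes p q r :: "nat \<Rightarrow> real"
  assumes "p \<longlonglongrightarrow> P" "q \<longlonglongrightarrow> Q" "r \<longlonglongrightarrow> R" "P > 0" "Q\<^sup>2 < 4 * P * R"
  obtains \<delta> where "\<delta> > 0"
    "\<forall>\<^sub>F n in sequentially. \<forall>a b. \<delta> * (a\<^sup>2 + b\<^sup>2) \<le> p n * a\<^sup>2 + q n * a * b + r n * b\<^sup>2"
proof -
  \<comment> \<open>The discriminant condition is open, so a small \<delta> can be subtracted from
    both diagonal coefficients of the limit form, and then for all large \<open>n\<close>.\<close>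
  have "((\<lambda>\<delta>. 4 * (P - \<delta>) * (R - \<delta>) - Q\<^sup>2) \<longlongrightarrow> 4 * (P - 0) * (R - 0) - Q\<^sup>2) (at_right 0)"
    by (intro tendsto_intros)
  then have "\<forall>\<^sub>F \<delta> in at_right 0. 0 < 4 * (P - \<delta>) * (R - \<delta>) - Q\<^sup>2"
    using assms(5) by (intro order_tendstoD) auto
  then have "\<forall>\<^sub>F \<delta> in at_right 0. 0 < 4 * (P - \<delta>) * (R - \<delta>) - Q\<^sup>2 \<and> \<delta> \<in> {0<..<P}"
    using eventually_at_right_real[OF assms(4)] by (auto elim: eventually_elim2)
  then obtain \<delta> where \<delta>: "0 < 4 * (P - \<delta>) * (R - \<delta>) - Q\<^sup>2" "0 < \<delta>" "\<delta> < P"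
    using eventually_happens'[OF trivial_limit_at_right_real] by fastforce
  have lim: "(\<lambda>n. 4 * (p n - \<delta>) * (r n - \<delta>) - (q n)\<^sup>2) \<longlonglongrightarrow> 4 * (P - \<delta>) * (R - \<delta>) - Q\<^sup>2"
    by (intro tendsto_intros assms)
  have "\<forall>\<^sub>F n in sequentially. 0 < 4 * (p n - \<delta>) * (r n - \<delta>) - (q n)\<^sup>2"
    by (rule order_tendstoD(1)[OF lim \<delta>(1)])
  moreover have "\<forall>\<^sub>F n in sequentially. \<delta> < p n"
    using \<delta> assms(1) by (intro order_tendstoD) auto
  ultimately have "\<forall>\<^sub>F n in sequentially. \<forall>a b. \<delta> * (a\<^sup>2 + b\<^sup>2) \<le> p n * a\<^sup>2 + q n * a * b + r n * b\<^sup>2"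
  proof eventually_elim
    case (elim n)
    show ?case
    proof (intro allI)
      fix a b :: real
      have "0 \<le> (2 * (p n - \<delta>) * a + q n * b)\<^sup>2 + (4 * (p n - \<delta>) * (r n - \<delta>) - (q n)\<^sup>2) * b\<^sup>2"
        using elim by simp
      also have "\<dots> = 4 * (p n - \<delta>) * ((p n - \<delta>) * a\<^sup>2 + q n * a * b + (r n - \<delta>) * b\<^sup>2)"
        by (simp add: power2_eq_square algebra_simps)
      finally have "0 \<le> (p n - \<delta>) * a\<^sup>2 + q n * a * b + (r n - \<delta>) * b\<^sup>2"
        using elim by (simp add: zero_le_mult_iff)
      then show "\<delta> * (a\<^sup>2 + b\<^sup>2) \<le> p n * a\<^sup>2 + q n * a * b + r n * b\<^sup>2"
        by (simp add: algebra_simps)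
    qed
  qed
  then show thesis using that \<delta> by blast
qed

lemma tendsto_affine_over_real: "(\<lambda>n. (a * real n + b) / real n) \<longlonglongrightarrow> a"
proof (rule Lim_transform_eventually)
  have "(\<lambda>n. a + b * (1 / real n)) \<longlonglongrightarrow> a + b * 0"
    by (intro tendsto_intros lim_1_over_n)
  then show "(\<lambda>n. a + b * (1 / real n)) \<longlonglongrightarrow> a" by simp
  show "\<forall>\<^sub>F n in sequentially. a + b * (1 / real n) = (a * real n + b) / real n"
    using eventually_gt_at_top[of 0] by eventually_elim (simp add: field_simps)
qed

lemma quasi_descent_convergent:
  fixes f g :: "nat \<Rightarrow> real"
  assumes "\<forall>\<^sub>F n in sequentially. f (Suc n) \<le> f n - g n" "\<forall>\<^sub>F n in sequentially. 0 \<le> f n"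
    "\<And>n. 0 \<le> g n"
  shows "convergent f" "summable g"
proof -
  have "\<forall>\<^sub>F n in sequentially. f (Suc n) \<le> f n - g n \<and> 0 \<le> f n"
    using assms(1,2) by eventually_elim simp
  then obtain N where N: "\<And>n. n \<ge> N \<Longrightarrow> f (Suc n) \<le> f n - g n \<and> 0 \<le> f n"
    by (auto simp: eventually_sequentially)
  have "f (Suc n + N) \<le> f (n + N)" for n
    using N[of "n + N"] assms(3)[of "n + N"] by simp
  then have "decseq (\<lambda>n. f (n + N))" by (simp add: decseq_Suc_iff)
  moreover have "\<And>n. 0 \<le> f (n + N)" using N by simp
  ultimately obtain L where "(\<lambda>n. f (n + N)) \<longlonglongrightarrow> L"
    by (metis decseq_convergent)
  then show "convergent f" using LIMSEQ_offset by (auto simp: convergent_def)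
  have "(\<Sum>i<n. g (i + N)) \<le> f N - f (n + N)" for n
  proof (induction n)
    case (Suc n)
    then show ?case using N[of "n + N"] by simp
  qed simp
  then have "(\<Sum>i<n. g (i + N)) \<le> f N" for n
    using N[of "n + N"] by (smt (verit) le_add2)
  then have "summable (\<lambda>n. g (n + N))"
    by (intro summableI_nonneg_bounded assms(3))
  then show "summable g" by (simp add: summable_iff_shift)
qed

text \<open>A positive limit would make the series dominate a multiple of the harmonic
  series.\<close>

lemma summable_over_index_imp_limit_zero:
  fixes f :: "nat \<Rightarrow> real"
  assumes "f \<longlonglongrightarrow> l" "\<And>n. 0 \<le> f n" "summable (\<lambda>n. f n / real n)"
  shows "l = 0"
proof (rule ccontr)
  assume "l \<noteq> 0"
  moreover have "0 \<le> l" by (rule LIMSEQ_le_const[OF assms(1)]) (use assms(2) in blast)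
  ultimately have l: "0 < l" by simp
  have "\<forall>\<^sub>F n in sequentially. l / 2 < f n"
    by (rule order_tendstoD(1)[OF assms(1)]) (use l in simp)
  then have "\<forall>\<^sub>F n in sequentially. norm (1 / real n) \<le> 2 / l * (f n / real n)"
  proof eventually_elim
    case (elim n)
    then have "1 \<le> 2 / l * f n" using l by (simp add: field_simps)
    then have "1 / real n \<le> (2 / l * f n) / real n" by (rule divide_right_mono) simp
    then show ?case by simp
  qed
  then have "summable (\<lambda>n. 1 / real n)"
    by (rule summable_comparison_test_ev) (intro summable_mult assms(3))
  then show False using not_summable_harmonic[where 'a=real] by (simp add: inverse_eq_divide)
qed

lemma tendsto_zero_power2_norm_le:
  assumes "\<forall>\<^sub>F n in F. (norm (f n))\<^sup>2 \<le> g n" "(g \<longlongrightarrow> 0) F"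
  shows "(f \<longlongrightarrow> 0) F"
proof (rule Lim_null_comparison)
  show "\<forall>\<^sub>F n in F. norm (f n) \<le> sqrt (g n)"
    using assms(1) by eventually_elim (simp add: real_le_rsqrt)
  show "((\<lambda>n. sqrt (g n)) \<longlongrightarrow> 0) F"
    using tendsto_real_sqrt[OF assms(2)] by simp
qed

lemma tendsto_inner_bounded_zero:
  assumes "\<And>n. norm (x n) \<le> B" "(f \<longlongrightarrow> 0) F"
  shows "((\<lambda>n. x n \<bullet> f n) \<longlongrightarrow> 0) F"
proof (rule Lim_null_comparison)
  have "norm (x n \<bullet> f n) \<le> B * norm (f n)" for n
    using order_trans[OF Cauchy_Schwarz_ineq2 mult_right_mono[OF assms(1) norm_ge_zero]] by simp
  then show "\<forall>\<^sub>F n in F. norm (x n \<bullet> f n) \<le> B * norm (f n)" by simp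
  show "((\<lambda>n. B * norm (f n)) \<longlongrightarrow> 0) F"
    using tendsto_mult[OF tendsto_const tendsto_norm[OF assms(2)], of B] by simp
qed

text \<open>The operators are reduced to three inequalities, so that the analysis can be
  instantiated with \<open>x n = z n - p\<close> for every zero \<open>p\<close>. The lower bound
  \<open>inner_ge\<close> is slightly negative because \<open>v n\<close> evaluates the forward
  operator at the preceding iterate.\<close>

locale fast_recursion =
  fixes x d v c :: "nat \<Rightarrow> 'a::real_inner" and \<alpha> \<beta> \<gamma> :: real
  assumes alpha: "\<alpha> > 2" and gamma: "0 < \<gamma>" "\<gamma> < 2 * \<beta>"
    and step: "\<And>n. n \<ge> 1 \<Longrightarrow> x (Suc n) = x n + d (Suc n)"
    and recursion: "\<And>n. n \<ge> 1 \<Longrightarrow> (real n + \<alpha>) *\<^sub>R d (Suc n)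
      = real n *\<^sub>R d n - (\<gamma> * (real n + \<alpha>)) *\<^sub>R (v (Suc n) - v n) - (\<gamma> * \<alpha> / 2) *\<^sub>R v n"
    and monotone: "\<And>n. n \<ge> 1 \<Longrightarrow> d (Suc n) \<bullet> c n \<le> d (Suc n) \<bullet> (v (Suc n) - v n)"
    and cocoercive: "\<And>n. n \<ge> 1 \<Longrightarrow> \<beta> * (norm (c n))\<^sup>2 \<le> d n \<bullet> c n"
    and inner_ge: "\<And>n. n \<ge> 1 \<Longrightarrow> - (norm (d n))\<^sup>2 / (4 * \<beta>) \<le> x n \<bullet> v n"
begin

section \<open>Decay and convergence of the energies along the recursion\<close>

abbreviation W where "W n \<equiv> weak_energy \<alpha> \<gamma> (real n) (x n) (d n) (v n)"
abbreviation S where "S n \<equiv> strong_energy \<alpha> \<gamma> (real n) (d n) (v n)"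

definition E :: "real \<Rightarrow> nat \<Rightarrow> real" where "E \<mu> n = 2 * \<mu> * W n + S n"

lemma beta: "0 < \<beta>" using gamma by simp

text \<open>The bound has a form in \<open>(a, b)\<close> of order n, a form in
  \<open>(f, g)\<close> of order n squared, and a cross term of order n. The delicate contribution
  is the product of the velocity with the increment of \<open>v\<close>, weighted by
  \<open>(t + \<alpha>)\<^sup>2\<close>; its bound supplies the \<open>g\<^sup>2\<close>
  term.\<close>

lemma energy_decrease:
  fixes \<mu> :: real and n :: nat
  defines "a \<equiv> norm (d (Suc n))" and "b \<equiv> norm (v (Suc n))"
    and "f \<equiv> norm (v (Suc n) - v n)" and "g \<equiv> norm (c n)"
    and "t \<equiv> real n"
  assumes n: "n \<ge> 1" and mu: "0 < \<mu>" "\<mu> < \<alpha> - 1"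
  shows "E \<mu> (Suc n) - E \<mu> n \<le>
    - ((2 * (\<alpha> - 1 - \<mu>) * (2 * t + \<alpha> + 1) - \<mu> * \<gamma> * (\<alpha> - 2) / (2 * \<beta>)) * a\<^sup>2
       - \<bar>4 * \<mu> * \<gamma> * (t + \<alpha>) - 2 * \<gamma> * (\<alpha> - 1) * (2 * t + \<alpha> + 1)\<bar> * a * b
       + \<gamma>\<^sup>2 / 2 * ((\<alpha> - 2) * (2 * t + \<alpha> + 1) - 1) * b\<^sup>2)
    - (t + \<alpha>) * (\<gamma>\<^sup>2 / 2 * (2 * t + \<alpha> + 1) * f\<^sup>2 - 2 * \<gamma>\<^sup>2 * (t + \<alpha> / 2) * f * g + 2 * \<gamma> * \<beta> * t * g\<^sup>2)
    + \<gamma>\<^sup>2 * \<alpha> * (t + \<alpha>) * b * (f + g)"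
proof -
  define D V e X where "D = d (Suc n)" and "V = v (Suc n)" and "e = v (Suc n) - v n" and "X = x (Suc n)"
  have t: "t \<ge> 1" using n by (simp add: t_def)
  have tS: "real (Suc n) = t + 1" by (simp add: t_def)
  have norms: "a = norm D" "b = norm V" "f = norm e"
    by (simp_all add: a_def b_def f_def D_def V_def e_def)
  have vn: "v n = V - e" by (simp add: V_def e_def)
  have xn: "x n = X - D" using step[OF n] by (simp add: X_def D_def)
  have "(\<gamma> * (t + \<alpha>)) *\<^sub>R e - (\<gamma> * \<alpha> / 2) *\<^sub>R e = (\<gamma> * (t + \<alpha> / 2)) *\<^sub>R e"
    unfolding scaleR_left_diff_distrib[symmetric] by (rule arg_cong[where f="\<lambda>r. r *\<^sub>R e"]) (simp add: field_simps)
  moreover have "t *\<^sub>R d n = (t + \<alpha>) *\<^sub>R D + (\<gamma> * (t + \<alpha>)) *\<^sub>R e + (\<gamma> * \<alpha> / 2) *\<^sub>R (V - e)"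
    using recursion[OF n] unfolding t_def[symmetric] D_def[symmetric] e_def[symmetric]
    by (simp add: vn)
  ultimately have td: "t *\<^sub>R d n = (t + \<alpha>) *\<^sub>R D + (\<gamma> * (t + \<alpha> / 2)) *\<^sub>R e + (\<gamma> * \<alpha> / 2) *\<^sub>R V"
    by (simp add: scaleR_right_diff_distrib algebra_simps)
  have "E \<mu> (Suc n) - E \<mu> n = 2 * \<mu> * (W (Suc n) - W n) + (S (Suc n) - S n)"
    by (simp add: E_def algebra_simps)
  also have "\<dots> = 2 * \<mu> * (- \<gamma> * (\<alpha> - 2) * (X \<bullet> V) + (2 * t + \<alpha> + 1) * (D \<bullet> D) + 2 * \<gamma> * (t + \<alpha>) * (D \<bullet> V))
     + (- 2 * (\<alpha> - 1) * (2 * t + \<alpha> + 1) * (D \<bullet> D)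
      - 2 * \<gamma> * (\<alpha> - 1) * (2 * t + \<alpha> + 1) * (D \<bullet> V)
      - \<gamma>\<^sup>2 / 2 * ((\<alpha> - 2) * (2 * t + \<alpha> + 1) - 1) * (V \<bullet> V)
      - 2 * \<gamma> * (t + \<alpha>)\<^sup>2 * (D \<bullet> e) - \<gamma>\<^sup>2 * (\<alpha> - 1) * (t + \<alpha>) * (V \<bullet> e)
      - \<gamma>\<^sup>2 / 2 * (t + \<alpha>) * (2 * t + \<alpha> + 1) * (e \<bullet> e))"
    using weak_energy_step[OF td, of X] strong_energy_step[OF td]
    by (simp only: tS D_def[symmetric] V_def[symmetric] X_def[symmetric] xn vn t_def[symmetric])
  also have "\<dots> = 2 * \<mu> * \<gamma> * (\<alpha> - 2) * (- (X \<bullet> V)) - 2 * (\<alpha> - 1 - \<mu>) * (2 * t + \<alpha> + 1) * a\<^sup>2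
      + (4 * \<mu> * \<gamma> * (t + \<alpha>) - 2 * \<gamma> * (\<alpha> - 1) * (2 * t + \<alpha> + 1)) * (D \<bullet> V)
      - \<gamma>\<^sup>2 / 2 * ((\<alpha> - 2) * (2 * t + \<alpha> + 1) - 1) * b\<^sup>2
      + 2 * \<gamma> * (t + \<alpha>)\<^sup>2 * (- (D \<bullet> e)) + \<gamma>\<^sup>2 * (\<alpha> - 1) * (t + \<alpha>) * (- (V \<bullet> e))
      - \<gamma>\<^sup>2 / 2 * (t + \<alpha>) * (2 * t + \<alpha> + 1) * f\<^sup>2"
    unfolding norms power2_norm_eq_inner
    by (simp add: algebra_simps)
  also have "\<dots> \<le> 2 * \<mu> * \<gamma> * (\<alpha> - 2) * (a\<^sup>2 / (4 * \<beta>)) - 2 * (\<alpha> - 1 - \<mu>) * (2 * t + \<alpha> + 1) * a\<^sup>2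
      + \<bar>4 * \<mu> * \<gamma> * (t + \<alpha>) - 2 * \<gamma> * (\<alpha> - 1) * (2 * t + \<alpha> + 1)\<bar> * (a * b)
      - \<gamma>\<^sup>2 / 2 * ((\<alpha> - 2) * (2 * t + \<alpha> + 1) - 1) * b\<^sup>2
      + 2 * \<gamma> * (t + \<alpha>) * (- (t * (\<beta> * g\<^sup>2)) + \<gamma> * (t + \<alpha> / 2) * (f * g) + \<gamma> * \<alpha> / 2 * (b * g))
      + \<gamma>\<^sup>2 * \<alpha> * (t + \<alpha>) * (b * f)
      - \<gamma>\<^sup>2 / 2 * (t + \<alpha>) * (2 * t + \<alpha> + 1) * f\<^sup>2"
  proof -
    have 1: "2 * \<mu> * \<gamma> * (\<alpha> - 2) * (- (X \<bullet> V)) \<le> 2 * \<mu> * \<gamma> * (\<alpha> - 2) * (a\<^sup>2 / (4 * \<beta>))"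
      using inner_ge[of "Suc n"] mu gamma alpha
      by (intro mult_left_mono) (auto simp: a_def X_def V_def)
    have 2: "q * (D \<bullet> V) \<le> \<bar>q\<bar> * (a * b)" for q
    proof -
      have "q * (D \<bullet> V) \<le> \<bar>q\<bar> * \<bar>D \<bullet> V\<bar>" by (metis abs_ge_self abs_mult)
      also have "\<dots> \<le> \<bar>q\<bar> * (a * b)"
        using Cauchy_Schwarz_ineq2[of D V] by (intro mult_left_mono) (auto simp: a_def b_def D_def V_def)
      finally show ?thesis .
    qed
    have De: "- (D \<bullet> e) \<le> - (D \<bullet> c n)"
      using monotone[OF n] by (simp add: D_def e_def)
    \<comment> \<open>Pairing the recursion with \<open>c n\<close> trades the new velocity for the
      old one, to which cocoercivity applies.\<close>
    have "t * (\<beta> * g\<^sup>2) \<le> t * (d n \<bullet> c n)"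
      using cocoercive[OF n] t by (intro mult_left_mono) (auto simp: g_def)
    also have "\<dots> = (t + \<alpha>) * (D \<bullet> c n) + \<gamma> * (t + \<alpha> / 2) * (e \<bullet> c n) + \<gamma> * \<alpha> / 2 * (V \<bullet> c n)"
      using arg_cong[OF td, of "\<lambda>w. w \<bullet> c n"] by (simp add: inner_simps)
    also have "\<gamma> * (t + \<alpha> / 2) * (e \<bullet> c n) \<le> \<gamma> * (t + \<alpha> / 2) * (f * g)"
      using norm_cauchy_schwarz[of e "c n"] gamma alpha t
      by (intro mult_left_mono) (auto simp: f_def g_def e_def)
    also have "\<gamma> * \<alpha> / 2 * (V \<bullet> c n) \<le> \<gamma> * \<alpha> / 2 * (b * g)"
      using norm_cauchy_schwarz[of V "c n"] gamma alpha
      by (intro mult_left_mono) (auto simp: b_def g_def V_def)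
    finally have Dc: "(t + \<alpha>) * (- (D \<bullet> c n)) \<le> - (t * (\<beta> * g\<^sup>2)) + \<gamma> * (t + \<alpha> / 2) * (f * g) + \<gamma> * \<alpha> / 2 * (b * g)"
      by simp
    have "2 * \<gamma> * (t + \<alpha>)\<^sup>2 * (- (D \<bullet> e)) \<le> 2 * \<gamma> * (t + \<alpha>)\<^sup>2 * (- (D \<bullet> c n))"
      using gamma by (intro mult_left_mono De) auto
    also have "\<dots> = 2 * \<gamma> * (t + \<alpha>) * ((t + \<alpha>) * (- (D \<bullet> c n)))"
      by (simp add: power2_eq_square)
    also have "\<dots> \<le> 2 * \<gamma> * (t + \<alpha>) * (- (t * (\<beta> * g\<^sup>2)) + \<gamma> * (t + \<alpha> / 2) * (f * g) + \<gamma> * \<alpha> / 2 * (b * g))"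
      using gamma alpha t by (intro mult_left_mono Dc) auto
    finally have 3: "2 * \<gamma> * (t + \<alpha>)\<^sup>2 * (- (D \<bullet> e)) \<le> \<dots>" .
    have "- (V \<bullet> e) \<le> b * f"
      using norm_cauchy_schwarz[of "- V" e] by (simp add: b_def f_def V_def e_def)
    then have "\<gamma>\<^sup>2 * (\<alpha> - 1) * (t + \<alpha>) * (- (V \<bullet> e)) \<le> \<gamma>\<^sup>2 * (\<alpha> - 1) * (t + \<alpha>) * (b * f)"
      using gamma alpha t by (intro mult_left_mono) auto
    \<comment> \<open>Enlarging \<alpha> - 1 to \<alpha> gives \<open>b * f\<close> the same
      coefficient as \<open>b * g\<close>.\<close>
    also have "\<dots> \<le> \<gamma>\<^sup>2 * \<alpha> * (t + \<alpha>) * (b * f)"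
      using gamma alpha t by (intro mult_right_mono mult_left_mono) (auto simp: b_def f_def)
    finally have 4: "\<gamma>\<^sup>2 * (\<alpha> - 1) * (t + \<alpha>) * (- (V \<bullet> e)) \<le> \<gamma>\<^sup>2 * \<alpha> * (t + \<alpha>) * (b * f)" .
    show ?thesis
      by (intro add_mono diff_mono order_refl 1 2 3 4)
  qed
  also have "\<dots> = - ((2 * (\<alpha> - 1 - \<mu>) * (2 * t + \<alpha> + 1) - \<mu> * \<gamma> * (\<alpha> - 2) / (2 * \<beta>)) * a\<^sup>2
       - \<bar>4 * \<mu> * \<gamma> * (t + \<alpha>) - 2 * \<gamma> * (\<alpha> - 1) * (2 * t + \<alpha> + 1)\<bar> * a * b
       + \<gamma>\<^sup>2 / 2 * ((\<alpha> - 2) * (2 * t + \<alpha> + 1) - 1) * b\<^sup>2)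
    - (t + \<alpha>) * (\<gamma>\<^sup>2 / 2 * (2 * t + \<alpha> + 1) * f\<^sup>2 - 2 * \<gamma>\<^sup>2 * (t + \<alpha> / 2) * f * g + 2 * \<gamma> * \<beta> * t * g\<^sup>2)
    + \<gamma>\<^sup>2 * \<alpha> * (t + \<alpha>) * b * (f + g)"
  proof -
    \<comment> \<open>The absolute value is hidden so that simplification treats it as an
      atom.\<close>
    define q where "q = \<bar>4 * \<mu> * \<gamma> * (t + \<alpha>) - 2 * \<gamma> * (\<alpha> - 1) * (2 * t + \<alpha> + 1)\<bar>"
    show ?thesis unfolding q_def[symmetric]
      using beta by (simp add: field_simps power2_eq_square)
  qed
  finally show ?thesis .
qed

text \<open>After scaling, the two forms have constant limits. The discriminant of the one in
  \<open>(a, b)\<close> has the right sign because \<open>s < \<alpha> - 2\<close>, that is \<mu> >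
  1; the one in \<open>(f, g)\<close> uses \<gamma> < 2\<beta>. The cross term is absorbed by
  both.\<close>

lemma energy_dissipation:
  assumes mu: "1 < \<mu>" "\<mu> < \<alpha> - 1"
  obtains \<kappa> where "\<kappa> > 0" "\<forall>\<^sub>F n in sequentially.
    E \<mu> (Suc n) \<le> E \<mu> n - \<kappa> * real n * ((norm (d (Suc n)))\<^sup>2 + (norm (v (Suc n)))\<^sup>2)"
proof -
  define s where "s = \<alpha> - 1 - \<mu>"
  have s: "0 < s" "s < \<alpha> - 2" using mu by (auto simp: s_def)
  define p1 where "p1 n = (4 * s * real n + (2 * s * (\<alpha> + 1) - \<mu> * \<gamma> * (\<alpha> - 2) / (2 * \<beta>))) / real n" for n
  define q1 where "q1 n = (- 4 * \<gamma> * s * real n + (4 * \<mu> * \<gamma> * \<alpha> - 2 * \<gamma> * (\<alpha> - 1) * (\<alpha> + 1))) / real n" for n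
  define r1 where "r1 n = (\<gamma>\<^sup>2 * (\<alpha> - 2) * real n + \<gamma>\<^sup>2 / 2 * ((\<alpha> - 2) * (\<alpha> + 1) - 1)) / real n" for n
  define p2 where "p2 n = (\<gamma>\<^sup>2 * real n + \<gamma>\<^sup>2 / 2 * (\<alpha> + 1)) / real n" for n
  define q2 where "q2 n = (2 * \<gamma>\<^sup>2 * real n + \<gamma>\<^sup>2 * \<alpha>) / real n" for n
  have p1: "p1 \<longlonglongrightarrow> 4 * s" and q1: "(\<lambda>n. - \<bar>q1 n\<bar>) \<longlonglongrightarrow> - \<bar>- 4 * \<gamma> * s\<bar>" and r1: "r1 \<longlonglongrightarrow> \<gamma>\<^sup>2 * (\<alpha> - 2)"
    and p2: "p2 \<longlonglongrightarrow> \<gamma>\<^sup>2" and q2: "(\<lambda>n. - q2 n) \<longlonglongrightarrow> - (2 * \<gamma>\<^sup>2)"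
    unfolding p1_def q1_def r1_def p2_def q2_def
    by (intro tendsto_minus tendsto_rabs tendsto_affine_over_real)+
  have "(- \<bar>- 4 * \<gamma> * s\<bar>)\<^sup>2 < 4 * (4 * s) * (\<gamma>\<^sup>2 * (\<alpha> - 2))"
  proof -
    have "16 * \<gamma>\<^sup>2 * s * s < 16 * \<gamma>\<^sup>2 * s * (\<alpha> - 2)"
      using s gamma by (intro mult_strict_left_mono) auto
    then show ?thesis by (simp add: power2_eq_square algebra_simps)
  qed
  then obtain \<delta>1 where \<delta>1: "\<delta>1 > 0" "\<forall>\<^sub>F n in sequentially. \<forall>a b.
      \<delta>1 * (a\<^sup>2 + b\<^sup>2) \<le> p1 n * a\<^sup>2 + (- \<bar>q1 n\<bar>) * a * b + r1 n * b\<^sup>2"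
    using s by (elim eventually_quadratic_form_ge[OF p1 q1 r1, rotated]) auto
  have "(- (2 * \<gamma>\<^sup>2))\<^sup>2 < 4 * \<gamma>\<^sup>2 * (2 * \<gamma> * \<beta>)"
  proof -
    have "4 * \<gamma> ^ 3 * \<gamma> < 4 * \<gamma> ^ 3 * (2 * \<beta>)"
      using gamma by (intro mult_strict_left_mono) auto
    then show ?thesis by (simp add: power2_eq_square power3_eq_cube algebra_simps)
  qed
  then obtain \<delta>2 where \<delta>2: "\<delta>2 > 0" "\<forall>\<^sub>F n in sequentially. \<forall>a b.
      \<delta>2 * (a\<^sup>2 + b\<^sup>2) \<le> p2 n * a\<^sup>2 + (- q2 n) * a * b + (2 * \<gamma> * \<beta>) * b\<^sup>2"
    using gamma by (elim eventually_quadratic_form_ge[OF p2 q2 tendsto_const, rotated]) auto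
  define k where "k = \<gamma>\<^sup>2 * \<alpha>"
  have "(\<lambda>n. k\<^sup>2 / (2 * \<delta>2) * ((1 * real n + \<alpha>) / real n) * (1 / real n)) \<longlonglongrightarrow> k\<^sup>2 / (2 * \<delta>2) * 1 * 0"
    by (intro tendsto_mult tendsto_const tendsto_affine_over_real lim_1_over_n)
  then have "\<forall>\<^sub>F n in sequentially. k\<^sup>2 / (2 * \<delta>2) * ((1 * real n + \<alpha>) / real n) * (1 / real n) < \<delta>1 / 2"
    using \<delta>1(1) by (intro order_tendstoD) auto
  moreover note \<delta>1(2) \<delta>2(2) eventually_ge_at_top[of 1]
  ultimately have "\<forall>\<^sub>F n in sequentially.
    E \<mu> (Suc n) \<le> E \<mu> n - \<delta>1 / 2 * real n * ((norm (d (Suc n)))\<^sup>2 + (norm (v (Suc n)))\<^sup>2)"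
  proof eventually_elim
    case (elim n)
    define a b f g t where "a = norm (d (Suc n))" and "b = norm (v (Suc n))"
      and "f = norm (v (Suc n) - v n)" and "g = norm (c n)" and "t = real n"
    have t: "t \<ge> 1" using elim by (simp add: t_def)
    define m where "m = t + \<alpha>"
    have m: "m > 0" using t alpha by (simp add: m_def)
    have "t * (\<delta>1 * (a\<^sup>2 + b\<^sup>2)) \<le> t * (p1 n * a\<^sup>2 + (- \<bar>q1 n\<bar>) * a * b + r1 n * b\<^sup>2)"
      using elim t by (intro mult_left_mono) auto
    also have "\<dots> = (t * p1 n) * a\<^sup>2 - (t * \<bar>q1 n\<bar>) * a * b + (t * r1 n) * b\<^sup>2"
      by (simp add: algebra_simps)
    also have "t * p1 n = 2 * (\<alpha> - 1 - \<mu>) * (2 * t + \<alpha> + 1) - \<mu> * \<gamma> * (\<alpha> - 2) / (2 * \<beta>)"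
      using t unfolding p1_def t_def[symmetric] by (simp add: s_def) (simp add: algebra_simps)
    also have "t * \<bar>q1 n\<bar> = \<bar>4 * \<mu> * \<gamma> * (t + \<alpha>) - 2 * \<gamma> * (\<alpha> - 1) * (2 * t + \<alpha> + 1)\<bar>"
    proof -
      have "t * \<bar>q1 n\<bar> = \<bar>t * q1 n\<bar>" using t by (simp add: abs_mult)
      also have "t * q1 n = 4 * \<mu> * \<gamma> * (t + \<alpha>) - 2 * \<gamma> * (\<alpha> - 1) * (2 * t + \<alpha> + 1)"
        using t unfolding q1_def t_def[symmetric] by (simp add: s_def) (simp add: algebra_simps)
      finally show ?thesis .
    qed
    also have "t * r1 n = \<gamma>\<^sup>2 / 2 * ((\<alpha> - 2) * (2 * t + \<alpha> + 1) - 1)"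
      using t unfolding r1_def t_def[symmetric] by simp (simp add: field_simps)
    finally have 1: "t * (\<delta>1 * (a\<^sup>2 + b\<^sup>2)) \<le>
      (2 * (\<alpha> - 1 - \<mu>) * (2 * t + \<alpha> + 1) - \<mu> * \<gamma> * (\<alpha> - 2) / (2 * \<beta>)) * a\<^sup>2
       - \<bar>4 * \<mu> * \<gamma> * (t + \<alpha>) - 2 * \<gamma> * (\<alpha> - 1) * (2 * t + \<alpha> + 1)\<bar> * a * b
       + \<gamma>\<^sup>2 / 2 * ((\<alpha> - 2) * (2 * t + \<alpha> + 1) - 1) * b\<^sup>2" .
    have "m * t * (\<delta>2 * (f\<^sup>2 + g\<^sup>2)) \<le> m * t * (p2 n * f\<^sup>2 + (- q2 n) * f * g + (2 * \<gamma> * \<beta>) * g\<^sup>2)"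
      using elim t m by (intro mult_left_mono) auto
    also have "\<dots> = m * ((t * p2 n) * f\<^sup>2 - (t * q2 n) * f * g + 2 * \<gamma> * \<beta> * t * g\<^sup>2)"
      by (simp add: algebra_simps)
    also have "t * p2 n = \<gamma>\<^sup>2 / 2 * (2 * t + \<alpha> + 1)"
      using t unfolding p2_def t_def[symmetric] by simp (simp add: field_simps)
    also have "t * q2 n = 2 * \<gamma>\<^sup>2 * (t + \<alpha> / 2)"
      using t unfolding q2_def t_def[symmetric] by simp (simp add: field_simps)
    finally have 2: "m * t * (\<delta>2 * (f\<^sup>2 + g\<^sup>2)) \<le>
      m * (\<gamma>\<^sup>2 / 2 * (2 * t + \<alpha> + 1) * f\<^sup>2 - 2 * \<gamma>\<^sup>2 * (t + \<alpha> / 2) * f * g + 2 * \<gamma> * \<beta> * t * g\<^sup>2)" .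
    \<comment> \<open>The weight is chosen so that the share of \<open>h\<close> is exactly what the
      second form provides; the remainder in \<open>b\<close> stays bounded and is negligible
      against the first form, which grows like \<open>t\<close>.\<close>
    have amgm: "k * b * h \<le> t * \<delta>2 * h\<^sup>2 + k\<^sup>2 * b\<^sup>2 / (4 * t * \<delta>2)" for h
    proof -
      have "0 \<le> (2 * t * \<delta>2 * h - k * b)\<^sup>2 / (4 * t * \<delta>2)" using t \<delta>2 by simp
      also have "\<dots> = t * \<delta>2 * h\<^sup>2 + k\<^sup>2 * b\<^sup>2 / (4 * t * \<delta>2) - k * b * h"
        using t \<delta>2 by (simp add: power2_eq_square field_simps)
      finally show ?thesis by simp
    qed
    have "k * m * b * (f + g) = m * (k * b * f + k * b * g)" by (simp add: algebra_simps)
    also have "\<dots> \<le> m * ((t * \<delta>2 * f\<^sup>2 + k\<^sup>2 * b\<^sup>2 / (4 * t * \<delta>2)) + (t * \<delta>2 * g\<^sup>2 + k\<^sup>2 * b\<^sup>2 / (4 * t * \<delta>2)))"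
      using m by (intro mult_left_mono add_mono amgm) auto
    also have "\<dots> = m * t * (\<delta>2 * (f\<^sup>2 + g\<^sup>2)) + t * (k\<^sup>2 / (2 * \<delta>2) * ((1 * t + \<alpha>) / t) * (1 / t)) * b\<^sup>2"
      using t \<delta>2 by (simp add: m_def field_simps power2_eq_square)
    also have "\<dots> \<le> m * t * (\<delta>2 * (f\<^sup>2 + g\<^sup>2)) + t * (\<delta>1 / 2) * b\<^sup>2"
      using elim(1) t unfolding t_def[symmetric]
      by (intro add_mono order_refl mult_right_mono mult_left_mono) auto
    also have "\<dots> \<le> m * t * (\<delta>2 * (f\<^sup>2 + g\<^sup>2)) + t * (\<delta>1 / 2) * (a\<^sup>2 + b\<^sup>2)"
      using t \<delta>1 by (intro add_mono order_refl mult_left_mono) auto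
    finally have 3: "k * m * b * (f + g) \<le> \<dots>" .
    have "E \<mu> (Suc n) - E \<mu> n \<le> - (t * (\<delta>1 * (a\<^sup>2 + b\<^sup>2))) - m * t * (\<delta>2 * (f\<^sup>2 + g\<^sup>2))
        + (m * t * (\<delta>2 * (f\<^sup>2 + g\<^sup>2)) + t * (\<delta>1 / 2) * (a\<^sup>2 + b\<^sup>2))"
      using energy_decrease[of n \<mu>] mu elim 1 2 3
      unfolding a_def[symmetric] b_def[symmetric] f_def[symmetric] g_def[symmetric] t_def[symmetric]
        m_def[symmetric] k_def[symmetric] by linarith
    also have "\<dots> = - (\<delta>1 / 2 * t * (a\<^sup>2 + b\<^sup>2))" by (simp add: field_simps)
    finally show ?case by (simp add: a_def b_def t_def)
  qed
  then show thesis using that[of "\<delta>1 / 2"] \<delta>1 by simp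
qed

text \<open>The negative part of the product of \<open>x\<close> and \<open>v\<close> is at most a
  multiple of the squared velocity, and \<open>2 * t\<close> times the velocity is a combination of
  the three vectors whose squares appear in \<open>energy_eq\<close>. The resulting factor
  \<open>\<theta> n\<close> tends to zero.\<close>

lemma energy_lower_bound:
  assumes mu: "0 < \<mu>" "\<mu> < \<alpha> - 1"
  shows "\<forall>\<^sub>F n in sequentially. \<mu> * (\<alpha> - 1 - \<mu>) * (norm (x n))\<^sup>2 \<le> E \<mu> n"
proof -
  define s where "s = \<alpha> - 1 - \<mu>"
  have s: "0 < s" using mu by (simp add: s_def)
  define \<theta> where "\<theta> n = 3 * \<mu> * \<gamma> / (8 * \<beta>) * ((1 * real n + \<alpha>) / real n) * (1 / real n)" for n
  have "\<theta> \<longlonglongrightarrow> 3 * \<mu> * \<gamma> / (8 * \<beta>) * 1 * 0"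
    unfolding \<theta>_def by (intro tendsto_mult tendsto_const tendsto_affine_over_real lim_1_over_n)
  then have \<theta>: "\<theta> \<longlonglongrightarrow> 0" by simp
  \<comment> \<open>The thresholds allow the error to use up the squares of \<open>u\<close> and
    \<open>v\<close>, but only half of the \<open>x\<close> term.\<close>
  have "\<forall>\<^sub>F n in sequentially. \<theta> n < 1 / 2" "\<forall>\<^sub>F n in sequentially. \<theta> n < s / (4 * \<mu>)"
    by (rule order_tendstoD(2)[OF \<theta>]; use s mu in simp)+
  then show ?thesis using eventually_ge_at_top[of 1]
  proof eventually_elim
    case (elim n)
    define t where "t = real n"
    have t: "t \<ge> 1" using elim by (simp add: t_def)
    define u where "u = (2 * \<mu>) *\<^sub>R x n + t *\<^sub>R (2 *\<^sub>R d n + \<gamma> *\<^sub>R v n)"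
    define A B D where "A = norm u" and "B = 2 * \<mu> * norm (x n)" and "D = \<gamma> * t * norm (v n)"
    have "norm ((2 * t) *\<^sub>R d n) = norm (u - (2 * \<mu>) *\<^sub>R x n - (\<gamma> * t) *\<^sub>R v n)"
      by (simp add: u_def algebra_simps)
    also have "\<dots> \<le> A + B + D"
      using norm_triangle_ineq4[of "u - (2 * \<mu>) *\<^sub>R x n" "(\<gamma> * t) *\<^sub>R v n"]
        norm_triangle_ineq4[of u "(2 * \<mu>) *\<^sub>R x n"] mu t gamma
      by (simp add: A_def B_def D_def abs_mult)
    finally have "(2 * t * norm (d n))\<^sup>2 \<le> (A + B + D)\<^sup>2"
      using t by (intro power_mono) auto
    also have "\<dots> \<le> 3 * (A\<^sup>2 + B\<^sup>2 + D\<^sup>2)"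
    proof -
      have "0 \<le> (A - B)\<^sup>2 + (A - D)\<^sup>2 + (B - D)\<^sup>2" by simp
      then show ?thesis by (simp add: power2_eq_square algebra_simps)
    qed
    finally have "(norm (d n))\<^sup>2 \<le> 3 / (4 * t\<^sup>2) * (A\<^sup>2 + B\<^sup>2 + D\<^sup>2)"
      using t by (simp add: field_simps power_mult_distrib)
    then have "2 * \<mu> * \<gamma> * (t + \<alpha>) * ((norm (d n))\<^sup>2 / (4 * \<beta>))
        \<le> 2 * \<mu> * \<gamma> * (t + \<alpha>) * (3 / (4 * t\<^sup>2) * (A\<^sup>2 + B\<^sup>2 + D\<^sup>2) / (4 * \<beta>))"
      using mu gamma beta t alpha by (intro mult_left_mono divide_right_mono) auto
    also have "\<dots> = \<theta> n * (A\<^sup>2 + B\<^sup>2 + D\<^sup>2)"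
      unfolding \<theta>_def t_def[symmetric] using t beta by (simp add: field_simps power2_eq_square)
    finally have 1: "2 * \<mu> * \<gamma> * (t + \<alpha>) * ((norm (d n))\<^sup>2 / (4 * \<beta>)) \<le> \<theta> n * A\<^sup>2 + \<theta> n * B\<^sup>2 + \<theta> n * D\<^sup>2"
      by (simp only: distrib_left)
    have 2: "\<theta> n * A\<^sup>2 \<le> 1 / 2 * A\<^sup>2" "\<theta> n * D\<^sup>2 \<le> 1 / 2 * D\<^sup>2" "\<theta> n * B\<^sup>2 \<le> s / (4 * \<mu>) * B\<^sup>2"
      using elim by (intro mult_right_mono; simp)+
    have 3: "s / (4 * \<mu>) * B\<^sup>2 = \<mu> * s * (norm (x n))\<^sup>2"
      using mu by (simp add: B_def field_simps power2_eq_square)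
    have "2 * \<mu> * \<gamma> * (t + \<alpha>) * (- ((norm (d n))\<^sup>2 / (4 * \<beta>))) \<le> 2 * \<mu> * \<gamma> * (t + \<alpha>) * (x n \<bullet> v n)"
      using inner_ge[of n] elim mu gamma t alpha by (intro mult_left_mono) auto
    moreover have "1 / 2 * D\<^sup>2 \<le> \<gamma>\<^sup>2 * (t + 1) * (t + \<alpha>) * (norm (v n))\<^sup>2 / 2"
    proof -
      have "t * t \<le> (t + 1) * (t + \<alpha>)" using t alpha by (intro mult_mono) auto
      then have "\<gamma>\<^sup>2 * (norm (v n))\<^sup>2 / 2 * (t * t) \<le> \<gamma>\<^sup>2 * (norm (v n))\<^sup>2 / 2 * ((t + 1) * (t + \<alpha>))"
        by (intro mult_left_mono) auto
      then show ?thesis by (simp add: D_def power2_eq_square algebra_simps)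
    qed
    moreover have "E \<mu> n = A\<^sup>2 / 2 + 2 * \<mu> * s * (norm (x n))\<^sup>2
      + 2 * \<mu> * \<gamma> * (t + \<alpha>) * (x n \<bullet> v n) + \<gamma>\<^sup>2 * (t + 1) * (t + \<alpha>) * (norm (v n))\<^sup>2 / 2"
      unfolding E_def A_def u_def s_def t_def by (rule energy_eq)
    ultimately have "\<mu> * s * (norm (x n))\<^sup>2 \<le> E \<mu> n" using 1 2 3 by linarith
    then show ?case by (simp add: s_def)
  qed
qed

lemma energy_convergent:
  assumes mu: "1 < \<mu>" "\<mu> < \<alpha> - 1"
  shows "convergent (E \<mu>)"
    and "summable (\<lambda>n. real n * ((norm (d (Suc n)))\<^sup>2 + (norm (v (Suc n)))\<^sup>2))"
proof -
  obtain \<kappa> where \<kappa>: "\<kappa> > 0" and dis: "\<forall>\<^sub>F n in sequentially.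
    E \<mu> (Suc n) \<le> E \<mu> n - \<kappa> * real n * ((norm (d (Suc n)))\<^sup>2 + (norm (v (Suc n)))\<^sup>2)"
    by (rule energy_dissipation[OF mu])
  have nonneg: "\<forall>\<^sub>F n in sequentially. 0 \<le> E \<mu> n"
    using energy_lower_bound[of \<mu>] mu
    by (auto elim!: eventually_mono intro: order_trans[rotated])
  note * = quasi_descent_convergent[OF dis nonneg]
  show "convergent (E \<mu>)" using \<kappa> by (intro *) auto
  have "summable (\<lambda>n. \<kappa> * real n * ((norm (d (Suc n)))\<^sup>2 + (norm (v (Suc n)))\<^sup>2))"
    using \<kappa> by (intro *) auto
  then show "summable (\<lambda>n. real n * ((norm (d (Suc n)))\<^sup>2 + (norm (v (Suc n)))\<^sup>2))"
    using \<kappa> by (simp add: mult.assoc summable_cmult_iff)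
qed

lemma strong_energy_nonneg: "0 \<le> S n"
  using alpha by (simp add: strong_energy_def)

lemma energies_converge: "\<exists>w. W \<longlonglongrightarrow> w" "S \<longlonglongrightarrow> 0"
proof -
  \<comment> \<open>The first value is the midpoint of 1 and \<alpha> - 1, the second the midpoint
    of 1 and the first; both are admissible and distinct since \<alpha> > 2.\<close>
  define \<mu> \<nu> where "\<mu> = \<alpha> / 2" and "\<nu> = (\<alpha> + 2) / 4"
  have mu: "1 < \<mu>" "\<mu> < \<alpha> - 1" and nu: "1 < \<nu>" "\<nu> < \<alpha> - 1" and ne: "\<mu> \<noteq> \<nu>"
    using alpha by (auto simp: \<mu>_def \<nu>_def)
  obtain L L' where L: "E \<mu> \<longlonglongrightarrow> L" "E \<nu> \<longlonglongrightarrow> L'"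
    using energy_convergent(1)[OF mu] energy_convergent(1)[OF nu] by (auto simp: convergent_def)
  have "(\<lambda>n. (E \<mu> n - E \<nu> n) / (2 * (\<mu> - \<nu>))) \<longlonglongrightarrow> (L - L') / (2 * (\<mu> - \<nu>))"
    using ne by (intro tendsto_intros L) auto
  also have "(\<lambda>n. (E \<mu> n - E \<nu> n) / (2 * (\<mu> - \<nu>))) = W"
    using ne by (auto simp: E_def field_simps)
  finally have W: "W \<longlonglongrightarrow> (L - L') / (2 * (\<mu> - \<nu>))" .
  then show "\<exists>w. W \<longlonglongrightarrow> w" by blast
  have "(\<lambda>n. E \<mu> n - 2 * \<mu> * W n) \<longlonglongrightarrow> L - 2 * \<mu> * ((L - L') / (2 * (\<mu> - \<nu>)))"
    by (intro tendsto_intros L W)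
  then obtain h where h: "S \<longlonglongrightarrow> h" by (auto simp: E_def)
  define K where "K = 4 + \<gamma>\<^sup>2 * (2 + \<alpha>)"
  have K: "K \<ge> 0" using alpha by (simp add: K_def)
  \<comment> \<open>Divided by \<open>n\<close>, the strong energy is thus at most a multiple of the
    summable dissipation; the shift to \<open>Suc n\<close> costs a factor 2.\<close>
  have S_le: "S n \<le> K * (real n)\<^sup>2 * ((norm (d n))\<^sup>2 + (norm (v n))\<^sup>2)" if "n \<ge> 1" for n
  proof -
    define t where "t = real n"
    have t: "t \<ge> 1" using that by (simp add: t_def)
    have "norm (2 *\<^sub>R d n + \<gamma> *\<^sub>R v n) \<le> 2 * norm (d n) + \<gamma> * norm (v n)"
      using norm_triangle_ineq[of "2 *\<^sub>R d n" "\<gamma> *\<^sub>R v n"] gamma by simp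
    then have "(norm (2 *\<^sub>R d n + \<gamma> *\<^sub>R v n))\<^sup>2 \<le> (2 * norm (d n) + \<gamma> * norm (v n))\<^sup>2"
      by (intro power_mono) auto
    also have "\<dots> \<le> 2 * (4 * (norm (d n))\<^sup>2 + \<gamma>\<^sup>2 * (norm (v n))\<^sup>2)"
    proof -
      have "0 \<le> (2 * norm (d n) - \<gamma> * norm (v n))\<^sup>2" by simp
      then show ?thesis by (simp add: power2_eq_square algebra_simps)
    qed
    finally have "t\<^sup>2 / 2 * (norm (2 *\<^sub>R d n + \<gamma> *\<^sub>R v n))\<^sup>2 \<le> t\<^sup>2 / 2 * \<dots>"
      by (intro mult_left_mono) auto
    moreover have "\<gamma>\<^sup>2 * (norm (v n))\<^sup>2 / 2 * ((t + 1) * (t + \<alpha>)) \<le> \<gamma>\<^sup>2 * (norm (v n))\<^sup>2 / 2 * ((2 * t) * ((1 + \<alpha>) * t))"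
      using t alpha by (intro mult_left_mono mult_mono) (auto simp: algebra_simps)
    moreover have "S n = t\<^sup>2 / 2 * (norm (2 *\<^sub>R d n + \<gamma> *\<^sub>R v n))\<^sup>2 + \<gamma>\<^sup>2 * (norm (v n))\<^sup>2 / 2 * ((t + 1) * (t + \<alpha>))"
      by (simp add: strong_energy_def t_def power_mult_distrib power2_norm_eq_inner[of "v n"])
    ultimately have "S n \<le> t\<^sup>2 / 2 * (2 * (4 * (norm (d n))\<^sup>2 + \<gamma>\<^sup>2 * (norm (v n))\<^sup>2))
        + \<gamma>\<^sup>2 * (norm (v n))\<^sup>2 / 2 * ((2 * t) * ((1 + \<alpha>) * t))"
      by linarith
    also have "\<dots> = 4 * t\<^sup>2 * (norm (d n))\<^sup>2 + \<gamma>\<^sup>2 * (2 + \<alpha>) * t\<^sup>2 * (norm (v n))\<^sup>2"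
      by (simp add: power2_eq_square algebra_simps)
    also have "\<dots> \<le> K * t\<^sup>2 * (norm (d n))\<^sup>2 + K * t\<^sup>2 * (norm (v n))\<^sup>2"
      using alpha by (intro add_mono mult_right_mono) (auto simp: K_def)
    finally show ?thesis by (simp add: t_def algebra_simps)
  qed
  have "summable (\<lambda>n. S (Suc n) / real (Suc n))"
  proof (rule summable_comparison_test_ev)
    show "summable (\<lambda>n. 2 * K * (real n * ((norm (d (Suc n)))\<^sup>2 + (norm (v (Suc n)))\<^sup>2)))"
      by (intro summable_mult energy_convergent(2)[OF mu])
    show "\<forall>\<^sub>F n in sequentially. norm (S (Suc n) / real (Suc n))
        \<le> 2 * K * (real n * ((norm (d (Suc n)))\<^sup>2 + (norm (v (Suc n)))\<^sup>2))"
      using eventually_ge_at_top[of 1]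
    proof eventually_elim
      case (elim n)
      define Q where "Q = (norm (d (Suc n)))\<^sup>2 + (norm (v (Suc n)))\<^sup>2"
      have "norm (S (Suc n) / real (Suc n)) = S (Suc n) / real (Suc n)"
        using strong_energy_nonneg[of "Suc n"] by simp
      also have "\<dots> \<le> (K * (real (Suc n))\<^sup>2 * Q) / real (Suc n)"
        unfolding Q_def by (intro divide_right_mono S_le) auto
      also have "\<dots> = K * Q * real (Suc n)" by (simp add: power2_eq_square)
      also have "\<dots> \<le> K * Q * (2 * real n)"
        using K elim by (intro mult_left_mono) (auto simp: Q_def)
      finally show ?case by (simp add: Q_def algebra_simps)
    qed
  qed
  then have "summable (\<lambda>n. S n / real n)"
    using summable_Suc_iff[of "\<lambda>n. S n / real n"] by blast
  then have "h = 0" by (rule summable_over_index_imp_limit_zero[OF h strong_energy_nonneg])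
  then show "S \<longlonglongrightarrow> 0" using h by simp
qed

text \<open>The second summand of \<open>S\<close> controls \<open>n\<close> times \<open>v\<close>;
  the first controls a combination with the velocity, from which the known part is
  subtracted.\<close>

lemma velocity_residual_tendsto_zero: "(\<lambda>n. real n *\<^sub>R d n) \<longlonglongrightarrow> 0" "(\<lambda>n. real n *\<^sub>R v n) \<longlonglongrightarrow> 0"
proof -
  note S = energies_converge(2)
  have "(\<lambda>n. real n *\<^sub>R (\<gamma> *\<^sub>R v n)) \<longlonglongrightarrow> 0"
  proof (rule tendsto_zero_power2_norm_le)
    show "(\<lambda>n. 2 * S n) \<longlonglongrightarrow> 0" using tendsto_mult[OF tendsto_const S, of 2] by simp
    have "(norm (real n *\<^sub>R (\<gamma> *\<^sub>R v n)))\<^sup>2 \<le> 2 * S n" for n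
    proof -
      have "real n * real n \<le> (real n + 1) * (real n + \<alpha>)" using alpha by (intro mult_mono) auto
      then have "\<gamma>\<^sup>2 * (norm (v n))\<^sup>2 * (real n * real n) \<le> \<gamma>\<^sup>2 * (norm (v n))\<^sup>2 * ((real n + 1) * (real n + \<alpha>))"
        by (intro mult_left_mono) auto
      also have "\<dots> \<le> 2 * S n"
      proof -
        have "2 * S n = (norm (real n *\<^sub>R (2 *\<^sub>R d n + \<gamma> *\<^sub>R v n)))\<^sup>2 + \<gamma>\<^sup>2 * (norm (v n))\<^sup>2 * ((real n + 1) * (real n + \<alpha>))"
          unfolding strong_energy_def power2_norm_eq_inner[of "v n"] by (simp add: algebra_simps del: norm_scaleR)
        then show ?thesis by (simp del: norm_scaleR)
      qed
      finally show ?thesis by (simp add: power_mult_distrib power2_eq_square algebra_simps)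
    qed
    then show "\<forall>\<^sub>F n in sequentially. (norm (real n *\<^sub>R (\<gamma> *\<^sub>R v n)))\<^sup>2 \<le> 2 * S n" by simp
  qed
  note v = this
  then have "(\<lambda>n. (1 / \<gamma>) *\<^sub>R (real n *\<^sub>R (\<gamma> *\<^sub>R v n))) \<longlonglongrightarrow> (1 / \<gamma>) *\<^sub>R 0"
    by (intro tendsto_intros)
  then show "(\<lambda>n. real n *\<^sub>R v n) \<longlonglongrightarrow> 0" using gamma by simp
  have "(\<lambda>n. real n *\<^sub>R (2 *\<^sub>R d n + \<gamma> *\<^sub>R v n)) \<longlonglongrightarrow> 0"
  proof (rule tendsto_zero_power2_norm_le)
    show "(\<lambda>n. 2 * S n) \<longlonglongrightarrow> 0" using tendsto_mult[OF tendsto_const S, of 2] by simp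
    show "\<forall>\<^sub>F n in sequentially. (norm (real n *\<^sub>R (2 *\<^sub>R d n + \<gamma> *\<^sub>R v n)))\<^sup>2 \<le> 2 * S n"
      using alpha by (simp add: strong_energy_def)
  qed
  from tendsto_scaleR[OF tendsto_const tendsto_diff[OF this v], of "1 / 2"]
  show "(\<lambda>n. real n *\<^sub>R d n) \<longlonglongrightarrow> 0" by (simp add: algebra_simps)
qed

lemma bounded_iterates: "\<exists>B. \<forall>n. norm (x n) \<le> B"
proof -
  define \<mu> where "\<mu> = \<alpha> / 2"
  have mu: "1 < \<mu>" "\<mu> < \<alpha> - 1" using alpha by (auto simp: \<mu>_def)
  define k where "k = \<mu> * (\<alpha> - 1 - \<mu>)"
  have k: "k > 0" using mu by (simp add: k_def)
  obtain L where L: "E \<mu> \<longlonglongrightarrow> L"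
    using energy_convergent(1)[OF mu] by (auto simp: convergent_def)
  have "\<forall>\<^sub>F n in sequentially. E \<mu> n < L + 1" by (rule order_tendstoD(2)[OF L]) simp
  moreover have "\<forall>\<^sub>F n in sequentially. k * (norm (x n))\<^sup>2 \<le> E \<mu> n"
    unfolding k_def using mu by (intro energy_lower_bound) auto
  ultimately have "\<forall>\<^sub>F n in sequentially. norm (x n) \<le> sqrt ((L + 1) / k)"
  proof eventually_elim
    case (elim n)
    then have "(norm (x n))\<^sup>2 \<le> (L + 1) / k" using k by (simp add: field_simps)
    then show ?case by (rule real_le_rsqrt)
  qed
  then have "Bfun x sequentially" by (rule BfunI)
  then show ?thesis by (auto simp: Bseq_def)
qed

lemma norm_square_convergent: "convergent (\<lambda>n. (norm (x n))\<^sup>2)"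
proof -
  obtain B where B: "\<And>n. norm (x n) \<le> B" using bounded_iterates by blast
  obtain w where w: "W \<longlonglongrightarrow> w" using energies_converge(1) by blast
  have v0: "v \<longlonglongrightarrow> 0"
  proof (rule Lim_null_comparison)
    show "\<forall>\<^sub>F n in sequentially. norm (v n) \<le> norm (real n *\<^sub>R v n)"
      using eventually_ge_at_top[of 1] by eventually_elim (simp add: mult_le_cancel_right1)
    show "(\<lambda>n. norm (real n *\<^sub>R v n)) \<longlonglongrightarrow> 0"
      using tendsto_norm[OF velocity_residual_tendsto_zero(2)] by simp
  qed
  \<comment> \<open>All terms of \<open>W\<close> except the squared norm are gathered into one
    product of the bounded \<open>x\<close> with a null sequence.\<close>
  have "(\<lambda>n. x n \<bullet> (2 *\<^sub>R (real n *\<^sub>R d n) + \<gamma> *\<^sub>R (2 *\<^sub>R (real n *\<^sub>R v n) + \<alpha> *\<^sub>R v n))) \<longlonglongrightarrow> 0"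
  proof (rule tendsto_inner_bounded_zero[OF B])
    have "(\<lambda>n. 2 *\<^sub>R (real n *\<^sub>R d n) + \<gamma> *\<^sub>R (2 *\<^sub>R (real n *\<^sub>R v n) + \<alpha> *\<^sub>R v n))
        \<longlonglongrightarrow> 2 *\<^sub>R 0 + \<gamma> *\<^sub>R (2 *\<^sub>R 0 + \<alpha> *\<^sub>R 0)"
      by (intro tendsto_intros velocity_residual_tendsto_zero v0)
    then show "(\<lambda>n. 2 *\<^sub>R (real n *\<^sub>R d n) + \<gamma> *\<^sub>R (2 *\<^sub>R (real n *\<^sub>R v n) + \<alpha> *\<^sub>R v n)) \<longlonglongrightarrow> 0"
      by simp
  qed
  then have "(\<lambda>n. (W n - x n \<bullet> (2 *\<^sub>R (real n *\<^sub>R d n) + \<gamma> *\<^sub>R (2 *\<^sub>R (real n *\<^sub>R v n) + \<alpha> *\<^sub>R v n))) / (\<alpha> - 1))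
      \<longlonglongrightarrow> (w - 0) / (\<alpha> - 1)"
    using alpha by (intro tendsto_intros w) auto
  also have "(\<lambda>n. (W n - x n \<bullet> (2 *\<^sub>R (real n *\<^sub>R d n) + \<gamma> *\<^sub>R (2 *\<^sub>R (real n *\<^sub>R v n) + \<alpha> *\<^sub>R v n))) / (\<alpha> - 1))
      = (\<lambda>n. (norm (x n))\<^sup>2)"
  proof
    fix n
    have "W n = (\<alpha> - 1) * (norm (x n))\<^sup>2
        + x n \<bullet> (2 *\<^sub>R (real n *\<^sub>R d n) + \<gamma> *\<^sub>R (2 *\<^sub>R (real n *\<^sub>R v n) + \<alpha> *\<^sub>R v n))"
      by (simp add: weak_energy_def power2_norm_eq_inner inner_simps algebra_simps)
    then show "(W n - x n \<bullet> (2 *\<^sub>R (real n *\<^sub>R d n) + \<gamma> *\<^sub>R (2 *\<^sub>R (real n *\<^sub>R v n) + \<alpha> *\<^sub>R v n))) / (\<alpha> - 1)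
        = (norm (x n))\<^sup>2"
      using alpha by simp
  qed
  finally show ?thesis by (auto simp: convergent_def)
qed

end

section \<open>The fast forward-backward method\<close>

lemma cocoercive_lipschitz:
  assumes "cocoercive \<beta> C" "\<beta> > 0"
  shows "\<beta> * norm (C x - C y) \<le> norm (x - y)"
proof (cases "C x = C y")
  case False
  have "\<beta> * (norm (C x - C y))\<^sup>2 \<le> norm (C x - C y) * norm (x - y)"
    using assms(1) norm_cauchy_schwarz[of "C x - C y" "x - y"] unfolding cocoercive_def
    by (meson order_trans)
  then show ?thesis using False by (simp add: power2_eq_square)
qed simp

text \<open>In the expanded square, cocoercivity and \<gamma> \<le> 2\<beta> let the mixed term
  outweigh the quadratic one.\<close>

lemma cocoercive_forward_nonexpansive:
  assumes "cocoercive \<beta> C" "0 \<le> \<gamma>" "\<gamma> \<le> 2 * \<beta>"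
  shows "norm ((x - \<gamma> *\<^sub>R C x) - (y - \<gamma> *\<^sub>R C y)) \<le> norm (x - y)"
proof (rule power2_le_imp_le)
  define a b where "a = x - y" and "b = C x - C y"
  have "\<gamma> * (norm b)\<^sup>2 \<le> 2 * \<beta> * (norm b)\<^sup>2" using assms(3) by (intro mult_right_mono) auto
  also have "\<dots> \<le> 2 * (b \<bullet> a)" using assms(1) by (simp add: cocoercive_def a_def b_def)
  finally have "\<gamma> * (\<gamma> * (norm b)\<^sup>2) \<le> \<gamma> * (2 * (b \<bullet> a))"
    using assms(2) by (rule mult_left_mono)
  moreover have "(norm (a - \<gamma> *\<^sub>R b))\<^sup>2 = (norm a)\<^sup>2 - \<gamma> * (2 * (b \<bullet> a)) + \<gamma> * (\<gamma> * (norm b)\<^sup>2)"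
    unfolding power2_norm_eq_inner by (simp add: inner_simps inner_commute[of a b] algebra_simps)
  ultimately have "(norm (a - \<gamma> *\<^sub>R b))\<^sup>2 \<le> (norm a)\<^sup>2" by linarith
  moreover have "(x - \<gamma> *\<^sub>R C x) - (y - \<gamma> *\<^sub>R C y) = a - \<gamma> *\<^sub>R b"
    by (simp add: a_def b_def algebra_simps)
  ultimately show "(norm ((x - \<gamma> *\<^sub>R C x) - (y - \<gamma> *\<^sub>R C y)))\<^sup>2 \<le> (norm (x - y))\<^sup>2"
    by (simp only: a_def)
qed simp

lemma sum_zeros_iff: "p \<in> sum_zeros M C \<longleftrightarrow> - C p \<in> M p"
proof -
  have "(0 = \<xi> + C p) = (\<xi> = - C p)" for \<xi>
    by (metis add_eq_0_iff2)
  then show ?thesis by (simp add: sum_zeros_def operator_sum_def)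
qed

lemma forward_backward_fixed_point:
  fixes M :: "'a::{real_inner, complete_space} \<Rightarrow> 'a set"
  assumes "maximally_monotone M" "\<gamma> > 0" "resolvent \<gamma> M (p - \<gamma> *\<^sub>R C p) = p"
  shows "p \<in> sum_zeros M C"
  using resolvent_mem[OF assms(1,2), of "p - \<gamma> *\<^sub>R C p"] assms(2)
  by (simp add: assms(3) sum_zeros_iff)

lemma smallo_inverse_realI:
  fixes f :: "nat \<Rightarrow> real"
  assumes "(\<lambda>k. real k * f k) \<longlonglongrightarrow> 0"
  shows "f \<in> o(\<lambda>k. 1 / real k)"
proof (rule smalloI_tendsto)
  show "(\<lambda>k. f k / (1 / real k)) \<longlonglongrightarrow> 0"
    using assms by (simp add: mult.commute)
  show "\<forall>\<^sub>F k in sequentially. 1 / real k \<noteq> 0"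
    using eventually_gt_at_top[of 0] by eventually_elim simp
qed

theorem theorem2p9:
  fixes M :: "'a::{real_inner, complete_space} \<Rightarrow> 'a set"
    and C :: "'a \<Rightarrow> 'a"
    and \<alpha> \<beta> \<gamma> :: real
    and z y \<xi> :: "nat \<Rightarrow> 'a"
    and zs :: 'a
  assumes "maximally_monotone M"
    and "\<beta> > 0"
    and "cocoercive \<beta> C"
    and "sum_zeros M C \<noteq> {}"
    and "\<alpha> > 2"
    and "0 < \<gamma>"
    and "\<gamma> < 8 * (\<alpha> - 1) / (5 * \<alpha> - 2) * \<beta>"
    and "z 1 = resolvent \<gamma> M (y 0 - \<gamma> *\<^sub>R C (z 0))"
    and "\<And>k. k \<ge> 1 \<Longrightarrow>
          y k = z k + (1 - \<alpha> / (real k + \<alpha>)) *\<^sub>R (z k - z (k - 1))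
                    + (1 - \<alpha> / (2 * (real k + \<alpha>))) *\<^sub>R (y (k - 1) - z k)"
    and "\<And>k. k \<ge> 1 \<Longrightarrow> z (k + 1) = resolvent \<gamma> M (y k - \<gamma> *\<^sub>R C (z k))"
    and "\<And>k. k \<ge> 1 \<Longrightarrow> \<xi> k = (1 / \<gamma>) *\<^sub>R (y (k - 1) - z k) - C (z (k - 1))"
    and "zs \<in> sum_zeros M C"
  shows "(\<forall>k\<ge>1. \<xi> k \<in> M (z k))
    \<and> (\<exists>l\<in>sum_zeros M C. weakly_converges z l)
    \<and> (\<lambda>k. norm (z k - z (k - 1))) \<in> o(\<lambda>k. 1 / real k)
    \<and> (\<lambda>k. (z k - zs) \<bullet> (\<xi> k + C (z k))) \<in> o(\<lambda>k. 1 / real k)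
    \<and> (\<lambda>k. norm (\<xi> k + C (z k))) \<in> o(\<lambda>k. 1 / real k)
    \<and> (\<lambda>k. infdist 0 (operator_sum M C (z k))) \<in> o(\<lambda>k. 1 / real k)
    \<and> (\<lambda>k. norm (z k - resolvent \<gamma> M (z k - \<gamma> *\<^sub>R C (z k)))) \<in> o(\<lambda>k. 1 / real k)"
proof -
  have resol: "z n = resolvent \<gamma> M (y (n - 1) - \<gamma> *\<^sub>R C (z (n - 1)))" if "n \<ge> 1" for n
    using assms(8) assms(10)[of "n - 1"] that by (cases "n = 1") auto
  have xi: "\<xi> n \<in> M (z n)" if "n \<ge> 1" for n
  proof -
    have "(1 / \<gamma>) *\<^sub>R (y (n - 1) - \<gamma> *\<^sub>R C (z (n - 1)) - z n) \<in> M (z n)"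
      using resolvent_mem[OF assms(1,6), of "y (n - 1) - \<gamma> *\<^sub>R C (z (n - 1))"]
      unfolding resol[OF that, symmetric] .
    then show ?thesis
      using assms(6) by (simp add: assms(11)[OF that] algebra_simps)
  qed
  have mono: "0 \<le> (u - v) \<bullet> (p - q)" if "u \<in> M p" "v \<in> M q" for u v p q
    using assms(1) that by (auto simp: maximally_monotone_def monotone_operator_def)
  \<comment> \<open>Since 8(\<alpha> - 1) is at most 2(5\<alpha> - 2), the step size satisfies
    \<gamma> < 2\<beta>, the form in which the bound enters the energy analysis and the
    nonexpansiveness of the forward step.\<close>
  have "8 * (\<alpha> - 1) / (5 * \<alpha> - 2) * \<beta> \<le> 2 * \<beta>"
    using assms(2,5) by (intro mult_right_mono) (auto simp: divide_simps)
  then have gamma: "\<gamma> < 2 * \<beta>" using assms(7) by simp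
  \<comment> \<open>At index 0 natural subtraction makes \<open>d\<close> and \<open>c\<close>
    vanish; all relations are stated for \<open>n \<ge> 1\<close>.\<close>
  define d v c w where "d n = z n - z (n - 1)" and "v n = (1 / \<gamma>) *\<^sub>R (y (n - 1) - z n)"
    and "c n = C (z n) - C (z (n - 1))" and "w n = \<xi> n + C (z n)" for n
  have v: "v n = \<xi> n + C (z (n - 1))" if "n \<ge> 1" for n
    using that by (simp add: v_def assms(11))
  have gv: "\<gamma> *\<^sub>R v n = y (n - 1) - z n" for n
    using assms(6) by (simp add: v_def)
  \<comment> \<open>An arbitrary zero is allowed here, because the weak limit argument needs
    convergent distances to every fixed point, not only to \<open>zs\<close>.\<close>
  have rec: "fast_recursion (\<lambda>n. z n - p) d v c \<alpha> \<beta> \<gamma>" if p: "p \<in> sum_zeros M C" for p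
  proof
    fix n :: nat assume n: "n \<ge> 1"
    show "z (Suc n) - p = z n - p + d (Suc n)" by (simp add: d_def)
    show "(real n + \<alpha>) *\<^sub>R d (Suc n)
      = real n *\<^sub>R d n - (\<gamma> * (real n + \<alpha>)) *\<^sub>R (v (Suc n) - v n) - (\<gamma> * \<alpha> / 2) *\<^sub>R v n"
    proof -
      define m where "m = real n + \<alpha>"
      have m: "m > 0" using assms(5) by (simp add: m_def)
      have "d (Suc n) = (1 - \<alpha> / m) *\<^sub>R d n + (1 - \<alpha> / (2 * m)) *\<^sub>R (\<gamma> *\<^sub>R v n) - \<gamma> *\<^sub>R v (Suc n)"
        using assms(9)[OF n] by (simp add: gv d_def m_def)
      then have "m *\<^sub>R d (Suc n) = (m * (1 - \<alpha> / m)) *\<^sub>R d n + (m * (1 - \<alpha> / (2 * m))) *\<^sub>R (\<gamma> *\<^sub>R v n) - (m * \<gamma>) *\<^sub>R v (Suc n)"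
        by (simp only: scaleR_add_right scaleR_diff_right scaleR_scaleR mult.assoc)
      also have "m * (1 - \<alpha> / m) = real n"
        using m by (simp add: right_diff_distrib) (simp add: m_def)
      also have "m * (1 - \<alpha> / (2 * m)) = m - \<alpha> / 2"
        using m by (simp add: right_diff_distrib)
      finally show ?thesis
        unfolding m_def[symmetric] by (simp add: algebra_simps)
    qed
    show "d (Suc n) \<bullet> c n \<le> d (Suc n) \<bullet> (v (Suc n) - v n)"
    proof -
      have "v (Suc n) - v n = (\<xi> (Suc n) - \<xi> n) + c n"
        using n by (simp add: v c_def)
      moreover have "0 \<le> (\<xi> (Suc n) - \<xi> n) \<bullet> d (Suc n)"
        using mono[OF xi xi, of "Suc n" n] n by (simp add: d_def)
      ultimately show ?thesis by (simp add: inner_add_right inner_commute)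
    qed
    show "\<beta> * (norm (c n))\<^sup>2 \<le> d n \<bullet> c n"
      using assms(3) by (simp add: cocoercive_def c_def d_def inner_commute)
    show "- (norm (d n))\<^sup>2 / (4 * \<beta>) \<le> (z n - p) \<bullet> v n"
    proof -
      \<comment> \<open>The product splits into a monotone part at \<open>z n\<close>, a cocoercive
        part at \<open>z (n - 1)\<close> and the error \<open>q \<bullet> d n\<close>; completing a
        square with the cocoercive gain gives the constant 1/(4\<beta>).\<close>
      define q where "q = C (z (n - 1)) - C p"
      have "0 \<le> (\<xi> n - - C p) \<bullet> (z n - p)"
        using p by (intro mono xi n) (simp add: sum_zeros_iff)
      moreover have "\<beta> * (norm q)\<^sup>2 \<le> q \<bullet> (z (n - 1) - p)"
        using assms(3) by (simp add: cocoercive_def q_def)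
      moreover have "(z n - p) \<bullet> v n = (\<xi> n - - C p) \<bullet> (z n - p) + q \<bullet> (z (n - 1) - p) + q \<bullet> d n"
        using n by (simp add: v q_def d_def inner_simps inner_commute)
      moreover have "- (norm q * norm (d n)) \<le> q \<bullet> d n"
        using Cauchy_Schwarz_ineq2[of q "d n"] by linarith
      moreover have "- (norm (d n))\<^sup>2 / (4 * \<beta>) \<le> \<beta> * (norm q)\<^sup>2 - norm q * norm (d n)"
      proof -
        have "0 \<le> (2 * \<beta> * norm q - norm (d n))\<^sup>2 / (4 * \<beta>)" using assms(2) by simp
        also have "\<dots> = \<beta> * (norm q)\<^sup>2 - norm q * norm (d n) + (norm (d n))\<^sup>2 / (4 * \<beta>)"
          using assms(2) by (simp add: power2_eq_square field_simps)
        finally show ?thesis by simp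
      qed
      ultimately show ?thesis by linarith
    qed
  qed (use assms gamma in auto)
  note limits = fast_recursion.velocity_residual_tendsto_zero[OF rec[OF assms(12)]]
  have nd: "(\<lambda>n. real n * norm (d n)) \<longlonglongrightarrow> 0" and nv: "(\<lambda>n. real n * norm (v n)) \<longlonglongrightarrow> 0"
    using tendsto_norm[OF limits(1)] tendsto_norm[OF limits(2)] by simp_all
  have nw: "(\<lambda>n. real n * norm (w n)) \<longlonglongrightarrow> 0"
  proof (rule Lim_null_comparison)
    have "(\<lambda>n. real n * norm (v n) + real n * norm (d n) / \<beta>) \<longlonglongrightarrow> 0 + 0 / \<beta>"
      using assms(2) by (intro tendsto_intros nd nv) simp
    then show "(\<lambda>n. real n * norm (v n) + real n * norm (d n) / \<beta>) \<longlonglongrightarrow> 0" by simp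
    show "\<forall>\<^sub>F n in sequentially. norm (real n * norm (w n)) \<le> real n * norm (v n) + real n * norm (d n) / \<beta>"
      using eventually_ge_at_top[of 1]
    proof eventually_elim
      case (elim n)
      \<comment> \<open>The residual at \<open>z n\<close> differs from \<open>v n\<close> only by
        re-evaluating \<open>C\<close>, an error the Lipschitz bound controls by the
        velocity.\<close>
      have "w n = v n + c n" using elim by (simp add: v w_def c_def)
      moreover have "norm (c n) \<le> norm (d n) / \<beta>"
        using cocoercive_lipschitz[OF assms(3,2), of "z n" "z (n - 1)"] assms(2)
        by (simp add: c_def d_def field_simps)
      ultimately have "norm (w n) \<le> norm (v n) + norm (d n) / \<beta>"
        using norm_triangle_ineq[of "v n" "c n"] by simp
      then have "real n * norm (w n) \<le> real n * (norm (v n) + norm (d n) / \<beta>)"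
        by (intro mult_left_mono) auto
      then show ?case by (simp add: distrib_left)
    qed
  qed
  define T where "T p = resolvent \<gamma> M (p - \<gamma> *\<^sub>R C p)" for p
  have T_nonexp: "norm (T p - T q) \<le> norm (p - q)" for p q
    unfolding T_def
    by (rule order_trans[OF resolvent_nonexpansive[OF assms(1,6)] cocoercive_forward_nonexpansive[OF assms(3)]])
      (use gamma assms(6) in auto)
  have T_residual: "norm (z n - T (z n)) \<le> \<gamma> * norm (w n)" if "n \<ge> 1" for n
  proof -
    \<comment> \<open>Writing \<open>z n\<close> as a resolvent value reduces the fixed-point
      residual to a distance between two arguments.\<close>
    have "resolvent \<gamma> M (z n + \<gamma> *\<^sub>R \<xi> n) = z n"
      using assms(1,6) xi[OF that] by (intro resolvent_eqI) (auto simp: maximally_monotone_def)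
    then have "norm (z n - T (z n)) \<le> norm ((z n + \<gamma> *\<^sub>R \<xi> n) - (z n - \<gamma> *\<^sub>R C (z n)))"
      using resolvent_nonexpansive[OF assms(1,6), of "z n + \<gamma> *\<^sub>R \<xi> n" "z n - \<gamma> *\<^sub>R C (z n)"]
      by (simp add: T_def)
    also have "(z n + \<gamma> *\<^sub>R \<xi> n) - (z n - \<gamma> *\<^sub>R C (z n)) = \<gamma> *\<^sub>R w n"
      by (simp add: w_def algebra_simps)
    finally show ?thesis using assms(6) by simp
  qed
  have nT: "(\<lambda>n. real n * norm (z n - T (z n))) \<longlonglongrightarrow> 0"
  proof (rule Lim_null_comparison)
    show "(\<lambda>n. \<gamma> * (real n * norm (w n))) \<longlonglongrightarrow> 0"
      using tendsto_mult[OF tendsto_const nw, of \<gamma>] by simp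
    show "\<forall>\<^sub>F n in sequentially. norm (real n * norm (z n - T (z n))) \<le> \<gamma> * (real n * norm (w n))"
      using eventually_ge_at_top[of 1]
      by eventually_elim (use T_residual in \<open>simp add: mult.left_commute mult_left_mono\<close>)
  qed
  obtain B where B: "\<And>n. norm (z n - zs) \<le> B"
    using fast_recursion.bounded_iterates[OF rec[OF assms(12)]] by blast
  have inner_lim: "(\<lambda>n. real n * ((z n - zs) \<bullet> w n)) \<longlonglongrightarrow> 0"
    using tendsto_inner_bounded_zero[OF B, of "\<lambda>n. real n *\<^sub>R w n"] nw
    by (simp add: tendsto_norm_zero_iff[symmetric, of "\<lambda>n. real n *\<^sub>R w n"])
  have dist_lim: "(\<lambda>n. real n * infdist 0 (operator_sum M C (z n))) \<longlonglongrightarrow> 0"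
  proof (rule Lim_null_comparison[OF _ nw])
    show "\<forall>\<^sub>F n in sequentially. norm (real n * infdist 0 (operator_sum M C (z n))) \<le> real n * norm (w n)"
      using eventually_ge_at_top[of 1]
    proof eventually_elim
      case (elim n)
      \<comment> \<open>Besides bounding the distance, this shows the set to be nonempty, so
        \<open>infdist\<close> is a true infimum and not its default value 0.\<close>
      then have "w n \<in> operator_sum M C (z n)" using xi by (auto simp: operator_sum_def w_def)
      from infdist_le[OF this, of 0] show ?case
        by (simp add: infdist_nonneg mult_left_mono)
    qed
  qed
  have "\<exists>l. T l = l \<and> weakly_converges z l"
  proof (rule nonexpansive_opial[OF T_nonexp])
    show "(\<lambda>n. z n - T (z n)) \<longlonglongrightarrow> 0"
    proof (rule Lim_null_comparison[OF _ nT])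
      show "\<forall>\<^sub>F n in sequentially. norm (z n - T (z n)) \<le> real n * norm (z n - T (z n))"
        using eventually_ge_at_top[of 1] by eventually_elim (simp add: mult_le_cancel_right1)
    qed
    show "convergent (\<lambda>n. (norm (z n - p))\<^sup>2)" if "T p = p" for p
      using that forward_backward_fixed_point[OF assms(1,6)]
      by (intro fast_recursion.norm_square_convergent[OF rec]) (simp add: T_def)
    show "norm (z n) \<le> B + norm zs" for n
      using norm_triangle_sub[of "z n" zs] B[of n] by simp
  qed
  then have weak: "\<exists>l\<in>sum_zeros M C. weakly_converges z l"
    using forward_backward_fixed_point[OF assms(1,6)] by (auto simp: T_def)
  show ?thesis
    using xi weak smallo_inverse_realI[OF nd] smallo_inverse_realI[OF inner_lim] smallo_inverse_realI[OF nw]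
      smallo_inverse_realI[OF dist_lim] smallo_inverse_realI[OF nT]
    unfolding d_def w_def T_def by blast
qed

end
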